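(* Let $G$ be a nonempty finite simple bipartite graph without isolated vertices. Then the cover ideal $J(G)$ is Scarf if and only if $G$ is a Ferrers graph.
   Context: Let $\Bbbk$ be a field and $S=\Bbbk[V(G)]$ the polynomial ring whose variables are the vertices of $G$. A vertex cover of $G$ is a set of vertices meeting every edge. The cover ideal is $J(G)=\left(\prod_{x\in W}x : W\subseteq V(G)\text{ is a vertex cover of }G\right)\subseteq S$. $N(x)$ is the set of vertices adjacent to $x$. A bipartite graph on two disjoint vertex sets $X=\{x_1,\dots,x_n\}$ and $Y=\{y_1,\dots,y_m\}$ (each edge joining $X$ to $Y$) is a Ferrers graph if, up to relabelling, $N(x_1)\subseteq N(x_2)\subseteq\cdots\subseteq N(x_n)=Y$. Scarf ideals: for a monomial ideal $I$ let $\operatorname{Mingens}(I)$ be its set of minimal monomial generators. The Taylor resolution of $S/I$ has free basis $e_\sigma$, $\sigma\subseteq\operatorname{Mingens}(I)$, with $e_\sigma$ in homological degree $|\sigma|$ and $\partial(e_\sigma)=\sum_{j=1}^t(-1)^{j+1}\frac{\operatorname{lcm}(\sigma)}{\operatorname{lcm}(\sigma\setminus\{m_{i_j}\})}e_{\sigma\setminus\{m_{i_j}\}}$ for $\sigma=\{m_{i_1},\dots,m_{i_t}\}$. The Scarf complex of $I$ is the simplicial complex of all $\sigma\subseteq\operatorname{Mingens}(I)$ such that $\operatorname{lcm}(\sigma)\neq\operatorname{lcm}(\tau)$ for every $\tau\subseteq\operatorname{Mingens}(I)$ with $\tau\neq\sigma$. It induces a subcomplex of the Taylor resolution (spanned by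 the $e_\sigma$ with $\sigma$ in the Scarf complex). $I$ is called Scarf if this subcomplex is a minimal free resolution of $S/I$ (equivalently, a free resolution of $S/I$). *)

theory Defs
  imports
    "Graph_Theory.Pair_Digraph"
    "HOL-Library.Poly_Mapping"
    "HOL-Algebra.QuotRing"
    "HOL-Algebra.Module"
begin

section \<open>Monomials and polynomial rings\<close>

text \<open>A monomial is represented by its exponent vector, so multiplication of monomials is
  addition of exponent vectors; a polynomial maps exponent vectors to coefficients.\<close>

type_synonym 'v mono = "'v \<Rightarrow>\<^sub>0 nat"
type_synonym ('v, 'k) mpoly = "'v mono \<Rightarrow>\<^sub>0 'k"

definition monom :: "'v mono \<Rightarrow> ('v, 'k::field) mpoly" where
  "monom m = Poly_Mapping.single m 1"

definition var :: "'v \<Rightarrow> ('v, 'k::field) mpoly" where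
  "var x = monom (Poly_Mapping.single x 1)"

definition poly_ring :: "'v set \<Rightarrow> ('v, 'k::field) mpoly ring" where
  "poly_ring V = \<lparr>carrier = {p. \<forall>m\<in>Poly_Mapping.keys p. Poly_Mapping.keys m \<subseteq> V},
     mult = (*), one = 1, zero = 0, add = (+)\<rparr>"

lemma cring_poly_ring: "cring (poly_ring V :: ('v, 'k::field) mpoly ring)"
proof (rule cringI)
  show "abelian_group (poly_ring V :: ('v, 'k) mpoly ring)"
  proof (rule abelian_groupI)
    fix p :: "('v, 'k) mpoly" assume p: "p \<in> carrier (poly_ring V)"
    show "\<exists>q\<in>carrier (poly_ring V). q \<oplus>\<^bsub>poly_ring V\<^esub> p = \<zero>\<^bsub>poly_ring V\<^esub>"
    proof (rule bexI[of _ "- p"])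
      have "Poly_Mapping.keys (- p) = Poly_Mapping.keys p"
        by (auto simp: in_keys_iff)
      thus "- p \<in> carrier (poly_ring V)" using p by (simp add: poly_ring_def)
    qed (simp add: poly_ring_def)
  next
    fix p q :: "('v, 'k) mpoly"
    assume "p \<in> carrier (poly_ring V)" "q \<in> carrier (poly_ring V)"
    thus "p \<oplus>\<^bsub>poly_ring V\<^esub> q \<in> carrier (poly_ring V)"
      using Poly_Mapping.keys_add[of p q] unfolding poly_ring_def by simp blast
  qed (simp_all add: poly_ring_def algebra_simps)
next
  show "comm_monoid (poly_ring V :: ('v, 'k) mpoly ring)"
  proof (rule comm_monoidI)
    fix p q :: "('v, 'k) mpoly"
    assume pq: "p \<in> carrier (poly_ring V)" "q \<in> carrier (poly_ring V)"
    have "Poly_Mapping.keys m \<subseteq> V" if "m \<in> Poly_Mapping.keys (p * q)" for m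
    proof -
      from that obtain a b where "m = a + b" "a \<in> Poly_Mapping.keys p" "b \<in> Poly_Mapping.keys q"
        using Poly_Mapping.keys_mult[of p q] by blast
      thus ?thesis using pq Poly_Mapping.keys_add[of a b] unfolding poly_ring_def by simp blast
    qed
    thus "p \<otimes>\<^bsub>poly_ring V\<^esub> q \<in> carrier (poly_ring V)" by (simp add: poly_ring_def)
  qed (simp_all add: poly_ring_def algebra_simps)
qed (simp_all add: poly_ring_def algebra_simps)

definition irrelevant_ideal :: "'v set \<Rightarrow> ('v, 'k::field) mpoly set" where
  "irrelevant_ideal V = Idl\<^bsub>poly_ring V\<^esub> (var ` V)"

definition mono_dvd :: "'v mono \<Rightarrow> 'v mono \<Rightarrow> bool" where
  "mono_dvd m m' \<longleftrightarrow> (\<exists>c. m' = m + c)"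

definition mono_lcm :: "'v mono set \<Rightarrow> 'v mono" where
  "mono_lcm \<sigma> = Abs_poly_mapping (\<lambda>x. Max (insert 0 ((\<lambda>m. Poly_Mapping.lookup m x) ` \<sigma>)))"

lemma lookup_mono_lcm:
  assumes "finite \<sigma>"
  shows "Poly_Mapping.lookup (mono_lcm \<sigma>) x = Max (insert 0 ((\<lambda>m. Poly_Mapping.lookup m x) ` \<sigma>))"
proof -
  have "{x. Max (insert 0 ((\<lambda>m. Poly_Mapping.lookup m x) ` \<sigma>)) \<noteq> 0} \<subseteq> (\<Union>m\<in>\<sigma>. Poly_Mapping.keys m)"
  proof
    fix x assume "x \<in> {x. Max (insert 0 ((\<lambda>m. Poly_Mapping.lookup m x) ` \<sigma>)) \<noteq> 0}"
    moreover have "Max (insert 0 ((\<lambda>m. Poly_Mapping.lookup m x) ` \<sigma>))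
        \<in> insert 0 ((\<lambda>m. Poly_Mapping.lookup m x) ` \<sigma>)"
      using assms by (intro Max_in) auto
    ultimately show "x \<in> (\<Union>m\<in>\<sigma>. Poly_Mapping.keys m)"
      by (force simp: in_keys_iff)
  qed
  hence "finite {x. Max (insert 0 ((\<lambda>m. Poly_Mapping.lookup m x) ` \<sigma>)) \<noteq> 0}"
    by (rule finite_subset) (use assms in auto)
  thus ?thesis unfolding mono_lcm_def by simp
qed

text \<open>The minimal monomial generators of a monomial ideal are the monomials of the ideal that are
  minimal with respect to divisibility.\<close>

definition mingens :: "('v, 'k::field) mpoly set \<Rightarrow> 'v mono set" where
  "mingens I = {m. monom m \<in> I \<and> (\<forall>m'. monom m' \<in> I \<and> mono_dvd m' m \<longrightarrow> m' = m)}"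

section \<open>Minimal free resolutions\<close>

text \<open>The ring multiplication and unit that the record type of modules inherits from rings
  play no role in a module.\<close>

definition free_module :: "('r, 'm) ring_scheme \<Rightarrow> 'b set \<Rightarrow> ('r, 'b \<Rightarrow> 'r) module" where
  "free_module R B = \<lparr>carrier = {f. (\<forall>b\<in>B. f b \<in> carrier R) \<and> (\<forall>b. b \<notin> B \<longrightarrow> f b = \<zero>\<^bsub>R\<^esub>)
                                  \<and> finite {b. f b \<noteq> \<zero>\<^bsub>R\<^esub>}},
     mult = undefined, one = undefined,
     zero = (\<lambda>b. \<zero>\<^bsub>R\<^esub>), add = (\<lambda>f g b. f b \<oplus>\<^bsub>R\<^esub> g b), smult = (\<lambda>r f b. r \<otimes>\<^bsub>R\<^esub> f b)\<rparr>"

definition quotient_module :: "('r, 'm) ring_scheme \<Rightarrow> 'r set \<Rightarrow> ('r, 'r set) module" where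
  "quotient_module R I = ring.extend (R Quot I)
     (module.fields (\<lambda>r X. (I +>\<^bsub>R\<^esub> r) \<otimes>\<^bsub>R Quot I\<^esub> X))"

definition module_hom ::
  "('r, 'm) ring_scheme \<Rightarrow> ('r, 'a, 'x) module_scheme \<Rightarrow> ('r, 'b, 'y) module_scheme \<Rightarrow> ('a \<Rightarrow> 'b) set"
  where
  "module_hom R M N = {h. h \<in> carrier M \<rightarrow> carrier N
     \<and> (\<forall>x\<in>carrier M. \<forall>y\<in>carrier M. h (x \<oplus>\<^bsub>M\<^esub> y) = h x \<oplus>\<^bsub>N\<^esub> h y)
     \<and> (\<forall>r\<in>carrier R. \<forall>x\<in>carrier M. h (r \<odot>\<^bsub>M\<^esub> x) = r \<odot>\<^bsub>N\<^esub> h x)}"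

text \<open>Exactness of \<open>\<dots> \<rightarrow> F\<^sub>2 \<rightarrow> F\<^sub>1 \<rightarrow> F\<^sub>0 \<rightarrow> M \<rightarrow> 0\<close>, where \<open>F\<^sub>i\<close> is free on the basis \<open>B i\<close>,
  the map \<open>F\<^sub>i\<^sub>+\<^sub>1 \<rightarrow> F\<^sub>i\<close> is \<open>d i\<close>, and \<open>F\<^sub>0 \<rightarrow> M\<close> is \<open>\<epsilon>\<close>.\<close>

definition free_resolution ::
  "('r, 'm) ring_scheme \<Rightarrow> ('r, 'a, 'x) module_scheme \<Rightarrow> (nat \<Rightarrow> 'b set)
    \<Rightarrow> (nat \<Rightarrow> ('b \<Rightarrow> 'r) \<Rightarrow> 'b \<Rightarrow> 'r) \<Rightarrow> (('b \<Rightarrow> 'r) \<Rightarrow> 'a) \<Rightarrow> bool" where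
  "free_resolution R M B d \<epsilon> \<longleftrightarrow>
     (\<forall>i. d i \<in> module_hom R (free_module R (B (Suc i))) (free_module R (B i)))
   \<and> \<epsilon> \<in> module_hom R (free_module R (B 0)) M
   \<and> \<epsilon> ` carrier (free_module R (B 0)) = carrier M
   \<and> d 0 ` carrier (free_module R (B 1)) = {f \<in> carrier (free_module R (B 0)). \<epsilon> f = \<zero>\<^bsub>M\<^esub>}
   \<and> (\<forall>i. d (Suc i) ` carrier (free_module R (B (Suc (Suc i))))
          = {f \<in> carrier (free_module R (B (Suc i))). d i f = \<zero>\<^bsub>free_module R (B i)\<^esub>})"

text \<open>A resolution is minimal with respect to the ideal \<open>\<mm>\<close> if the image of \<open>F\<^sub>i\<^sub>+\<^sub>1\<close> is contained
  in \<open>\<mm>F\<^sub>i\<close>, that is, if all coordinates of its elements lie in \<open>\<mm>\<close>.\<close>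

definition minimal_free_resolution ::
  "('r, 'm) ring_scheme \<Rightarrow> 'r set \<Rightarrow> ('r, 'a, 'x) module_scheme \<Rightarrow> (nat \<Rightarrow> 'b set)
    \<Rightarrow> (nat \<Rightarrow> ('b \<Rightarrow> 'r) \<Rightarrow> 'b \<Rightarrow> 'r) \<Rightarrow> (('b \<Rightarrow> 'r) \<Rightarrow> 'a) \<Rightarrow> bool" where
  "minimal_free_resolution R \<mm> M B d \<epsilon> \<longleftrightarrow> free_resolution R M B d \<epsilon>
   \<and> (\<forall>i. \<forall>f\<in>carrier (free_module R (B (Suc i))). \<forall>b\<in>B i. d i f b \<in> \<mm>)"

section \<open>Scarf ideals\<close>

definition basis_vector :: "'v mono set \<Rightarrow> 'v mono set \<Rightarrow> ('v, 'k::field) mpoly" where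
  "basis_vector \<sigma> = (\<lambda>\<tau>. if \<tau> = \<sigma> then 1 else 0)"

text \<open>The differential depends on a numbering \<open>idx\<close> of the minimal generators. If \<open>m\<close> is the
  \<open>j\<close>-th element of \<open>\<sigma>\<close>, then \<open>j - 1\<close> elements of \<open>\<sigma>\<close> have a smaller number, so the
  sign \<open>(-1)\<^bsup>j+1\<^esup>\<close> is \<open>(-1)\<^bsup>j-1\<^esup>\<close>. The quotient of the lcms is a difference of exponent vectors.\<close>

definition taylor_basis_diff ::
  "('v mono \<Rightarrow> nat) \<Rightarrow> 'v mono set \<Rightarrow> 'v mono set \<Rightarrow> ('v, 'k::field) mpoly" where
  "taylor_basis_diff idx \<sigma> = (\<lambda>\<tau>. \<Sum>m\<in>\<sigma>. (- 1) ^ card {m'\<in>\<sigma>. idx m' < idx m}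
     * monom (mono_lcm \<sigma> - mono_lcm (\<sigma> - {m})) * basis_vector (\<sigma> - {m}) \<tau>)"

definition taylor_diff ::
  "('v, 'k::field) mpoly set \<Rightarrow> ('v mono \<Rightarrow> nat) \<Rightarrow> ('v mono set \<Rightarrow> ('v, 'k) mpoly)
    \<Rightarrow> 'v mono set \<Rightarrow> ('v, 'k) mpoly" where
  "taylor_diff I idx f = (\<lambda>\<tau>. \<Sum>\<sigma>\<in>Pow (mingens I). f \<sigma> * taylor_basis_diff idx \<sigma> \<tau>)"

definition scarf_complex :: "('v, 'k::field) mpoly set \<Rightarrow> 'v mono set set" where
  "scarf_complex I = {\<sigma>. \<sigma> \<subseteq> mingens I
     \<and> (\<forall>\<tau>. \<tau> \<subseteq> mingens I \<and> \<tau> \<noteq> \<sigma> \<longrightarrow> mono_lcm \<sigma> \<noteq> mono_lcm \<tau>)}"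

text \<open>The free module on the Scarf faces of cardinality \<open>i\<close> is literally the submodule of the
  Taylor module spanned by the corresponding basis elements, and the differential is
  the Taylor differential itself. Two numberings of the generators give isomorphic
  complexes. The augmentation sends the basis element of the empty face to the class of \<open>1\<close>.\<close>

definition scarf_ideal :: "'v set \<Rightarrow> ('v, 'k::field) mpoly set \<Rightarrow> bool" where
  "scarf_ideal V I \<longleftrightarrow> (\<exists>idx. bij_betw idx (mingens I) {1..card (mingens I)}
     \<and> minimal_free_resolution (poly_ring V) (irrelevant_ideal V) (quotient_module (poly_ring V) I)
         (\<lambda>i. {\<sigma> \<in> scarf_complex I. card \<sigma> = i})
         (\<lambda>i. taylor_diff I idx)
         (\<lambda>f. I +>\<^bsub>poly_ring V\<^esub> f {}))"

section \<open>Graphs and cover ideals\<close>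

text \<open>A finite simple graph is a \<^locale>\<open>pair_graph\<close>: a finite vertex set with a symmetric irreflexive
  relation \<open>parcs\<close> on it, each edge being represented by both of its orientations.\<close>

definition neighbours :: "'v pair_pre_digraph \<Rightarrow> 'v \<Rightarrow> 'v set" where
  "neighbours G x = {y. (x, y) \<in> parcs G}"

definition vertex_cover :: "'v pair_pre_digraph \<Rightarrow> 'v set \<Rightarrow> bool" where
  "vertex_cover G W \<longleftrightarrow> W \<subseteq> pverts G \<and> (\<forall>(x, y)\<in>parcs G. x \<in> W \<or> y \<in> W)"

definition cover_ideal :: "'v pair_pre_digraph \<Rightarrow> ('v, 'k::field) mpoly set" where
  "cover_ideal G = Idl\<^bsub>poly_ring (pverts G)\<^esub> {\<Prod>x\<in>W. var x | W. vertex_cover G W}"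

definition bipartition :: "'v pair_pre_digraph \<Rightarrow> 'v set \<Rightarrow> 'v set \<Rightarrow> bool" where
  "bipartition G X Y \<longleftrightarrow> X \<inter> Y = {} \<and> X \<union> Y = pverts G
     \<and> (\<forall>(x, y)\<in>parcs G. x \<in> X \<and> y \<in> Y \<or> x \<in> Y \<and> y \<in> X)"

definition bipartite :: "'v pair_pre_digraph \<Rightarrow> bool" where
  "bipartite G \<longleftrightarrow> (\<exists>X Y. bipartition G X Y)"

text \<open>The list \<open>xs\<close> is the relabelling \<open>x\<^sub>1, \<dots>, x\<^sub>n\<close> of \<open>X\<close>.\<close>

definition ferrers_graph :: "'v pair_pre_digraph \<Rightarrow> bool" where
  "ferrers_graph G \<longleftrightarrow> (\<exists>X Y xs. bipartition G X Y \<and> distinct xs \<and> set xs = X \<and> xs \<noteq> []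
     \<and> (\<forall>i. Suc i < length xs \<longrightarrow> neighbours G (xs ! i) \<subseteq> neighbours G (xs ! Suc i))
     \<and> neighbours G (last xs) = Y)"

end

(* Order the minimal vertex covers of a bipartite graph by inclusion of their X-parts. The union of
   two comparable covers contains exactly the minimal covers between them, and the union of two
   incomparable ones contains a third minimal cover (refining their meet). Hence the Scarf complex
   is always the Hasse diagram of this order. Two incomparable covers give two different saturated
   paths from the cover Y to the cover X, so a cycle, i.e. a kernel element in the last module of the
   Scarf complex; if the order is a chain, the complex is a path and exactness is shown by
   eliminating generators from the top. Finally, the minimal covers form a chain iff the
   neighbourhoods of the vertices in X are nested. *)

theory Submission
  imports Defs
begin

section \<open>Monomials and monomial ideals\<close>

text \<open>The Scarf condition only sees which generators divide the lcm of others: such a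
  generator can be put into or taken out of a face without changing its lcm. For minimal covers this
  is controlled by one fact: the \<open>Y\<close>-part shrinks exactly when the
  \<open>X\<close>-part grows. Three elements never form a face, so the complex has length at most
  two whether or not \<open>G\<close> is Ferrers. Minimality is automatic, because a Scarf face and
  its facets have different lcms. Hence the only possible failure used in the forward direction is
  non-injectivity of the last differential. Two obstacles shape the cycle argument. The edges of a
  path carry different lcms, so their boundaries do not telescope by themselves; all edges are
  therefore raised to one common degree, the lcm of all generators. And a closed combination of
  paths could vanish identically; recording that each path stays in an order interval excludes this.
  All of it is carried out for an abstract ordered set of generators, so graphs enter only through a
  few statements about minimal covers.\<close>

lemma mono_dvd_iff:
  "mono_dvd m m' \<longleftrightarrow> (\<forall>x. Poly_Mapping.lookup m x \<le> Poly_Mapping.lookup m' x)"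
proof
  assume "\<forall>x. Poly_Mapping.lookup m x \<le> Poly_Mapping.lookup m' x"
  then have "m' = m + (m' - m)"
    by (intro poly_mapping_eqI) (simp add: lookup_add lookup_minus)
  then show "mono_dvd m m'" unfolding mono_dvd_def by blast
qed (auto simp: mono_dvd_def lookup_add)

lemma mono_dvd_refl [simp]: "mono_dvd m m"
  by (simp add: mono_dvd_iff)

lemma mono_dvd_trans [trans]: "mono_dvd a b \<Longrightarrow> mono_dvd b c \<Longrightarrow> mono_dvd a c"
  by (meson mono_dvd_iff le_trans)

lemma mono_dvd_antisym: "mono_dvd a b \<Longrightarrow> mono_dvd b a \<Longrightarrow> a = b"
  by (meson mono_dvd_iff order_antisym poly_mapping_eqI)

lemma mono_dvd_add [simp]: "mono_dvd a (a + b)" "mono_dvd a (b + a)"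
  by (simp_all add: mono_dvd_iff lookup_add)

lemma mono_dvd_0_iff [simp]: "mono_dvd m 0 \<longleftrightarrow> m = 0"
  by (auto simp: mono_dvd_iff intro: poly_mapping_eqI)

lemma mono_add_diff: "mono_dvd a b \<Longrightarrow> a + (b - a) = b"
  by (intro poly_mapping_eqI) (simp add: mono_dvd_iff lookup_add lookup_minus)

lemma mono_diff_add: "mono_dvd a b \<Longrightarrow> (b - a) + a = b"
  by (simp add: mono_add_diff add.commute)

lemma keys_mono_diff: "Poly_Mapping.keys (a - b :: 'v mono) \<subseteq> Poly_Mapping.keys a"
  by (auto simp: in_keys_iff lookup_minus)

lemma keys_mono_mono: "mono_dvd a b \<Longrightarrow> Poly_Mapping.keys a \<subseteq> Poly_Mapping.keys b"
  by (auto simp: in_keys_iff mono_dvd_iff) (metis gr0I le_zero_eq neq0_conv)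

text \<open>Subtraction of exponent vectors truncates at zero; the two divisibilities make the
  differences genuine quotients, which then multiply.\<close>

lemma mono_diff_telescope:
  assumes "mono_dvd a b" "mono_dvd b c"
  shows "(c - b) + (b - a) = (c - a :: 'v mono)"
  using assms by (intro poly_mapping_eqI) (simp add: mono_dvd_iff lookup_add lookup_minus)

lemma mono_lcm_dvd_iff:
  "finite \<sigma> \<Longrightarrow> mono_dvd (mono_lcm \<sigma>) a \<longleftrightarrow> (\<forall>m\<in>\<sigma>. mono_dvd m a)"
  by (auto simp: mono_dvd_iff lookup_mono_lcm)

lemma dvd_mono_lcm: "finite \<sigma> \<Longrightarrow> m \<in> \<sigma> \<Longrightarrow> mono_dvd m (mono_lcm \<sigma>)"
  using mono_lcm_dvd_iff mono_dvd_refl by blast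

lemma mono_lcm_subset: "finite \<tau> \<Longrightarrow> \<sigma> \<subseteq> \<tau> \<Longrightarrow> mono_dvd (mono_lcm \<sigma>) (mono_lcm \<tau>)"
  by (meson dvd_mono_lcm finite_subset mono_lcm_dvd_iff subsetD)

lemma mono_lcm_insert:
  assumes "finite \<sigma>" "mono_dvd m (mono_lcm \<sigma>)"
  shows "mono_lcm (insert m \<sigma>) = mono_lcm \<sigma>"
  by (rule mono_dvd_antisym) (use assms in \<open>auto simp: mono_lcm_dvd_iff dvd_mono_lcm\<close>)

lemma mono_lcm_empty [simp]: "mono_lcm {} = 0"
  by (rule poly_mapping_eqI) (simp add: lookup_mono_lcm)

lemma mono_lcm_singleton [simp]: "mono_lcm {m} = m"
  by (rule poly_mapping_eqI) (simp add: lookup_mono_lcm)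

lemma keys_mono_lcm:
  "finite \<sigma> \<Longrightarrow> Poly_Mapping.keys (mono_lcm \<sigma>) = (\<Union>m\<in>\<sigma>. Poly_Mapping.keys m)"
  by (auto simp: in_keys_iff lookup_mono_lcm Max_gr_iff neq0_conv)

lemma monom_mult: "monom a * monom b = monom (a + b)"
  by (simp add: monom_def mult_single)

lemma monom_0 [simp]: "monom 0 = 1"
  by (simp add: monom_def)

lemma keys_monom [simp]: "Poly_Mapping.keys (monom a :: ('v, 'k::field) mpoly) = {a}"
  by (simp add: monom_def)

lemma monom_neq_0 [simp]: "(monom a :: ('v, 'k::field) mpoly) \<noteq> 0"
  by (metis keys_monom keys_zero insert_not_empty)

text \<open>Multiplication by a monomial shifts exponents, which turns divisibility questions about
  polynomials into questions about single exponent vectors.\<close>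

lemma lookup_monom_times:
  fixes p :: "('v, 'k::field) mpoly"
  shows "Poly_Mapping.lookup (monom m * p) k
    = (if mono_dvd m k then Poly_Mapping.lookup p (k - m) else 0)"
proof (induction p rule: update_induct)
  case const
  show ?case by simp
next
  case (update p a b)
  have "Poly_Mapping.update a b p = p + Poly_Mapping.single a b"
    using update(1) by (intro poly_mapping_eqI)
      (auto simp: lookup_update lookup_add lookup_single when_def in_keys_iff)
  moreover have "m + a = k \<longleftrightarrow> mono_dvd m k \<and> a = k - m"
    by (auto simp: mono_add_diff)
  ultimately show ?case
    using update(3)
    by (auto simp: distrib_left lookup_add monom_def mult_single lookup_single when_def)
qed

lemma lookup_monom_times_add [simp]:
  "Poly_Mapping.lookup (monom m * p) (m + k) = Poly_Mapping.lookup p k"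
  by (simp add: lookup_monom_times)

lemma monom_times_eq_0_iff [simp]: "monom m * p = 0 \<longleftrightarrow> p = 0"
  by (metis lookup_monom_times_add lookup_zero mult_zero_right poly_mapping_eqI)

lemma monom_times_quotient:
  fixes p :: "('v, 'k::field) mpoly"
  assumes "\<forall>k\<in>Poly_Mapping.keys p. mono_dvd m k"
  obtains q where "p = monom m * q" "\<And>k. k \<in> Poly_Mapping.keys q \<Longrightarrow> m + k \<in> Poly_Mapping.keys p"
proof
  \<comment> \<open>This pulls \<open>p\<close> back along the injective shift by \<open>m\<close>.
    Only coefficients at exponents not divisible by \<open>m\<close> could get lost, and these
    vanish by assumption.\<close>
  define q where "q = Poly_Mapping.map_key ((+) m) p"
  have q: "Poly_Mapping.lookup q k = Poly_Mapping.lookup p (m + k)" for k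
    unfolding q_def by (subst map_key.rep_eq) (simp_all add: inj_on_def)
  show "p = monom m * q"
    by (rule poly_mapping_eqI) (use assms in
      \<open>auto simp: lookup_monom_times q mono_add_diff in_keys_iff\<close>)
  show "m + k \<in> Poly_Mapping.keys p" if "k \<in> Poly_Mapping.keys q" for k
    using that by (simp add: in_keys_iff q)
qed

lemma poly_ring_simps [simp]:
  "mult (poly_ring V) = (*)" "one (poly_ring V) = 1" "zero (poly_ring V) = 0" "add (poly_ring V) = (+)"
  by (simp_all add: poly_ring_def)

lemma poly_ring_carrier_iff:
  "p \<in> carrier (poly_ring V) \<longleftrightarrow> (\<forall>m\<in>Poly_Mapping.keys p. Poly_Mapping.keys m \<subseteq> V)"
  by (simp add: poly_ring_def)

lemma ring_poly_ring: "ring (poly_ring V)"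
  using cring_poly_ring cring.axioms(1) by blast

lemma poly_ring_zero [simp]: "0 \<in> carrier (poly_ring V)"
  by (simp add: poly_ring_carrier_iff)

lemma poly_ring_one [simp]: "1 \<in> carrier (poly_ring V)"
  by (simp add: poly_ring_carrier_iff)

lemma poly_ring_add [intro]:
  "p \<in> carrier (poly_ring V) \<Longrightarrow> q \<in> carrier (poly_ring V) \<Longrightarrow> p + q \<in> carrier (poly_ring V)"
  using ring.ring_simprules(1)[OF ring_poly_ring] by simp

lemma poly_ring_mult [intro]:
  "p \<in> carrier (poly_ring V) \<Longrightarrow> q \<in> carrier (poly_ring V) \<Longrightarrow> p * q \<in> carrier (poly_ring V)"
  using ring.ring_simprules(5)[OF ring_poly_ring] by simp

lemma poly_ring_uminus [intro]:
  "p \<in> carrier (poly_ring V) \<Longrightarrow> - p \<in> carrier (poly_ring V)"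
  by (auto simp: poly_ring_carrier_iff in_keys_iff)

lemma poly_ring_diff [intro]:
  "p \<in> carrier (poly_ring V) \<Longrightarrow> q \<in> carrier (poly_ring V) \<Longrightarrow> p - q \<in> carrier (poly_ring V)"
  using poly_ring_add[of p V "- q"] by auto

lemma poly_ring_sum [intro]:
  "(\<And>x. x \<in> A \<Longrightarrow> f x \<in> carrier (poly_ring V)) \<Longrightarrow> sum f A \<in> carrier (poly_ring V)"
  by (induction A rule: infinite_finite_induct) auto

lemma poly_ring_sign [simp, intro]: "(- 1) ^ n \<in> carrier (poly_ring V)"
  by (induction n) auto

lemma poly_ring_monom [intro]: "Poly_Mapping.keys m \<subseteq> V \<Longrightarrow> monom m \<in> carrier (poly_ring V)"
  by (simp add: poly_ring_carrier_iff)

text \<open>Membership is a condition on each exponent separately, so no combination of generators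
  has to be carried along. If the exponents in \<open>A\<close> are supported in \<open>V\<close>,
  this is the ideal generated by \<open>A\<close>.\<close>

definition monomial_ideal :: "'v set \<Rightarrow> 'v mono set \<Rightarrow> ('v, 'k::field) mpoly set" where
  "monomial_ideal V A
    = {p \<in> carrier (poly_ring V). \<forall>m\<in>Poly_Mapping.keys p. \<exists>a\<in>A. mono_dvd a m}"

lemma monomial_ideal_add:
  "p \<in> monomial_ideal V A \<Longrightarrow> q \<in> monomial_ideal V A \<Longrightarrow> p + q \<in> monomial_ideal V A"
  using Poly_Mapping.keys_add[of p q] by (auto simp: monomial_ideal_def)

lemma monomial_ideal_mult:
  assumes p: "p \<in> monomial_ideal V A" and q: "q \<in> carrier (poly_ring V)"
  shows "q * p \<in> monomial_ideal V A"
proof -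
  have "\<exists>a\<in>A. mono_dvd a m" if "m \<in> Poly_Mapping.keys (q * p)" for m
  proof -
    from that obtain b c where "m = b + c" "c \<in> Poly_Mapping.keys p"
      using Poly_Mapping.keys_mult[of q p] by blast
    moreover from this p obtain a where "a \<in> A" "mono_dvd a c"
      by (auto simp: monomial_ideal_def)
    ultimately show ?thesis by (meson mono_dvd_add(2) mono_dvd_trans)
  qed
  then show ?thesis using p q by (auto simp: monomial_ideal_def)
qed

lemma monomial_ideal_zero [simp]: "0 \<in> monomial_ideal V A"
  by (simp add: monomial_ideal_def)

lemma monomial_ideal_sum:
  "(\<And>x. x \<in> B \<Longrightarrow> f x \<in> monomial_ideal V A) \<Longrightarrow> sum f B \<in> monomial_ideal V A"
  by (induction B rule: infinite_finite_induct)
     (auto intro: monomial_ideal_add)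

lemma monom_in_monomial_ideal_iff:
  "monom m \<in> monomial_ideal V A \<longleftrightarrow> Poly_Mapping.keys m \<subseteq> V \<and> (\<exists>a\<in>A. mono_dvd a m)"
  by (auto simp: monomial_ideal_def poly_ring_carrier_iff)

lemma ideal_monomial_ideal:
  "ideal (monomial_ideal V A :: ('v, 'k::field) mpoly set) (poly_ring V)"
proof (rule idealI[OF ring_poly_ring])
  interpret cring "poly_ring V :: ('v, 'k) mpoly ring" by (rule cring_poly_ring)
  show "subgroup (monomial_ideal V A :: ('v, 'k) mpoly set) (add_monoid (poly_ring V))"
  proof (rule subgroup.intro)
    fix p :: "('v, 'k) mpoly"
    assume p: "p \<in> monomial_ideal V A"
    have "\<ominus>\<^bsub>poly_ring V\<^esub> p = - p"
      using p by (intro minus_equality) (simp_all add: monomial_ideal_def poly_ring_uminus)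
    moreover have "- p \<in> monomial_ideal V A"
      using monomial_ideal_mult[OF p poly_ring_uminus[OF poly_ring_one]] by simp
    ultimately show "inv\<^bsub>add_monoid (poly_ring V)\<^esub> p \<in> monomial_ideal V A"
      by (simp add: a_inv_def)
  next
    show "monomial_ideal V A \<subseteq> carrier (add_monoid (poly_ring V :: ('v, 'k) mpoly ring))"
      by (simp add: monomial_ideal_def)
  qed (simp_all add: monomial_ideal_add)
next
  fix p q :: "('v, 'k) mpoly"
  assume pq: "p \<in> monomial_ideal V A" "q \<in> carrier (poly_ring V)"
  show "q \<otimes>\<^bsub>poly_ring V\<^esub> p \<in> monomial_ideal V A"
    using monomial_ideal_mult[OF pq] by simp
  then show "p \<otimes>\<^bsub>poly_ring V\<^esub> q \<in> monomial_ideal V A"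
    by (simp add: mult.commute)
qed

lemma sum_single_keys:
  "(\<Sum>m\<in>Poly_Mapping.keys p. Poly_Mapping.single m (Poly_Mapping.lookup p m)) = p"
proof (rule poly_mapping_eqI)
  fix k
  have "Poly_Mapping.lookup (\<Sum>m\<in>Poly_Mapping.keys p. Poly_Mapping.single m (Poly_Mapping.lookup p m)) k
      = (\<Sum>m\<in>Poly_Mapping.keys p. if m = k then Poly_Mapping.lookup p m else 0)"
    unfolding lookup_sum by (rule sum.cong) (simp_all add: lookup_single when_def)
  also have "\<dots> = Poly_Mapping.lookup p k"
    by (simp add: in_keys_iff)
  finally show "Poly_Mapping.lookup
    (\<Sum>m\<in>Poly_Mapping.keys p. Poly_Mapping.single m (Poly_Mapping.lookup p m)) k
    = Poly_Mapping.lookup p k" .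
qed

text \<open>For the harder inclusion, every single term of a polynomial on the right is a multiple
  of one generator, and the polynomial is the sum of its terms.\<close>

lemma genideal_monom:
  fixes A :: "'v mono set"
  assumes A: "\<And>a. a \<in> A \<Longrightarrow> Poly_Mapping.keys a \<subseteq> V"
  shows "Idl\<^bsub>poly_ring V\<^esub> (monom ` A) = (monomial_ideal V A :: ('v, 'k::field) mpoly set)"
    (is "?I = ?J")
proof
  interpret cring "poly_ring V :: ('v, 'k) mpoly ring" by (rule cring_poly_ring)
  have sub: "monom ` A \<subseteq> carrier (poly_ring V :: ('v, 'k) mpoly ring)"
    using A by (auto simp: poly_ring_carrier_iff)
  show "?I \<subseteq> ?J"
  proof (rule genideal_minimal[OF ideal_monomial_ideal], rule image_subsetI)
    show "monom a \<in> ?J" if "a \<in> A" for a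
      unfolding monom_in_monomial_ideal_iff using that A[OF that] mono_dvd_refl[of a] by blast
  qed
  interpret I: ideal ?I "poly_ring V" by (rule genideal_ideal[OF sub])
  show "?J \<subseteq> ?I"
  proof
    fix p :: "('v, 'k) mpoly" assume p: "p \<in> ?J"
    have single: "Poly_Mapping.single m c \<in> ?I" if m: "m \<in> Poly_Mapping.keys p" for m c
    proof -
      from p m obtain a where a: "a \<in> A" "mono_dvd a m"
        by (auto simp: monomial_ideal_def)
      have mV: "Poly_Mapping.keys m \<subseteq> V"
        using p m by (simp add: monomial_ideal_def poly_ring_carrier_iff)
      have "Poly_Mapping.keys (m - a) \<subseteq> V" by (rule order_trans[OF keys_mono_diff mV])
      then have "Poly_Mapping.single (m - a) c \<in> carrier (poly_ring V :: ('v, 'k) mpoly ring)"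
        by (auto simp: poly_ring_carrier_iff)
      then have "Poly_Mapping.single (m - a) c * monom a \<in> ?I"
        using I.I_l_closed[of "monom a"] genideal_self[OF sub] a by auto
      then show ?thesis using a by (simp add: monom_def mult_single mono_diff_add)
    qed
    have sum: "sum f B \<in> ?I" if "\<And>x. x \<in> B \<Longrightarrow> f x \<in> ?I" for B :: "'v mono set" and f
      using that
    proof (induction B rule: infinite_finite_induct)
      case (insert x F)
      then show ?case using I.a_closed[of "f x" "sum f F"] by simp
    qed (use I.zero_closed in simp_all)
    have "(\<Sum>m\<in>Poly_Mapping.keys p. Poly_Mapping.single m (Poly_Mapping.lookup p m)) \<in> ?I"
      by (rule sum) (rule single)
    then show "p \<in> ?I" unfolding sum_single_keys .
  qed
qed

text \<open>Assign to every exponent of \<open>p\<close> one generator dividing it and collect terms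
  by assigned generator. The \<open>h a\<close> later provide a preimage under the first
  differential.\<close>

lemma monomial_ideal_combination:
  fixes p :: "('v, 'k::field) mpoly"
  assumes "finite A" and p: "p \<in> monomial_ideal V A"
  obtains h where "\<And>a. a \<in> A \<Longrightarrow> h a \<in> carrier (poly_ring V)" "p = (\<Sum>a\<in>A. h a * monom a)"
proof -
  have "\<forall>k\<in>Poly_Mapping.keys p. \<exists>a\<in>A. mono_dvd a k"
    using p by (simp add: monomial_ideal_def)
  then obtain g where g: "\<And>k. k \<in> Poly_Mapping.keys p \<Longrightarrow> g k \<in> A \<and> mono_dvd (g k) k"
    by metis
  define h :: "'v mono \<Rightarrow> ('v, 'k) mpoly" where
    "h a = (\<Sum>k\<in>{k\<in>Poly_Mapping.keys p. g k = a}. Poly_Mapping.single (k - a) (Poly_Mapping.lookup p k))" for a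
  have "h a \<in> carrier (poly_ring V)" for a
    unfolding h_def
  proof (rule poly_ring_sum)
    fix k assume "k \<in> {k\<in>Poly_Mapping.keys p. g k = a}"
    then have "Poly_Mapping.keys k \<subseteq> V"
      using p by (simp add: monomial_ideal_def poly_ring_carrier_iff)
    then have "Poly_Mapping.keys (k - a) \<subseteq> V" by (rule order_trans[OF keys_mono_diff])
    then show "Poly_Mapping.single (k - a) (Poly_Mapping.lookup p k) \<in> carrier (poly_ring V)"
      by (simp add: poly_ring_carrier_iff)
  qed
  moreover have "p = (\<Sum>a\<in>A. h a * monom a)"
  proof -
    have "(\<Sum>a\<in>A. h a * monom a)
      = (\<Sum>a\<in>A. \<Sum>k\<in>{k\<in>Poly_Mapping.keys p. g k = a}. Poly_Mapping.single k (Poly_Mapping.lookup p k))"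
      unfolding h_def sum_distrib_right
      by (intro sum.cong refl) (use g in \<open>auto simp: monom_def mult_single mono_diff_add\<close>)
    also have "\<dots> = p"
      using g by (subst sum.group) (auto simp: assms(1) sum_single_keys)
    finally show ?thesis by (rule sym)
  qed
  ultimately show thesis by (rule that)
qed

lemma mingens_monomial_ideal:
  fixes A :: "'v mono set"
  assumes keys: "\<And>a. a \<in> A \<Longrightarrow> Poly_Mapping.keys a \<subseteq> V"
    and antichain: "\<And>a b. a \<in> A \<Longrightarrow> b \<in> A \<Longrightarrow> mono_dvd a b \<Longrightarrow> a = b"
  shows "mingens (monomial_ideal V A :: ('v, 'k::field) mpoly set) = A"
proof -
  have in_A: "monom a \<in> (monomial_ideal V A :: ('v, 'k) mpoly set)" if "a \<in> A" for a
    unfolding monom_in_monomial_ideal_iff using keys that mono_dvd_refl by blast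
  have "m \<in> A" if "m \<in> mingens (monomial_ideal V A :: ('v, 'k) mpoly set)" for m
    using that in_A unfolding mingens_def monom_in_monomial_ideal_iff by blast
  moreover have "m \<in> mingens (monomial_ideal V A :: ('v, 'k) mpoly set)" if "m \<in> A" for m
  proof -
    have "m' = m" if m': "monom m' \<in> (monomial_ideal V A :: ('v, 'k) mpoly set)" "mono_dvd m' m" for m'
    proof -
      obtain a where a: "a \<in> A" "mono_dvd a m'"
        using m'(1) unfolding monom_in_monomial_ideal_iff by blast
      then have "a = m" using antichain \<open>m \<in> A\<close> mono_dvd_trans m'(2) by blast
      then show ?thesis using a(2) m'(2) mono_dvd_antisym by blast
    qed
    then show ?thesis using in_A[OF that] unfolding mingens_def by blast
  qed
  ultimately show ?thesis by blast
qed

lemma irrelevant_ideal_eq: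
  "(irrelevant_ideal V :: ('v, 'k::field) mpoly set)
    = monomial_ideal V ((\<lambda>x. Poly_Mapping.single x 1) ` V)"
proof -
  have "(var ` V :: ('v, 'k) mpoly set) = monom ` (\<lambda>x. Poly_Mapping.single x 1) ` V"
    by (auto simp: var_def)
  then show ?thesis
    unfolding irrelevant_ideal_def by (simp only:) (rule genideal_monom, auto)
qed

lemma monom_in_irrelevant_ideal:
  assumes "m \<noteq> 0" "Poly_Mapping.keys m \<subseteq> V"
  shows "monom m \<in> irrelevant_ideal V"
proof -
  obtain x where "x \<in> Poly_Mapping.keys m" using assms(1) by (metis ex_in_conv keys_eq_empty)
  then have "mono_dvd (Poly_Mapping.single x 1) m"
    by (auto simp: mono_dvd_iff lookup_single when_def in_keys_iff)
  then show ?thesis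
    using assms \<open>x \<in> Poly_Mapping.keys m\<close>
    by (auto simp: irrelevant_ideal_eq monom_in_monomial_ideal_iff)
qed

section \<open>The Taylor differential\<close>

text \<open>Only the sets \<open>insert m \<tau>\<close> with \<open>m\<close> outside
  \<open>\<tau>\<close> have \<open>\<tau>\<close> as a facet. The coefficient at
  \<open>\<tau>\<close> thus becomes a sum over generators instead of a sum over all
  subsets.\<close>

lemma taylor_diff_eq:
  fixes I :: "('v, 'k::field) mpoly set"
  assumes fin: "finite (mingens I)"
  shows "taylor_diff I idx f \<tau> = (if \<tau> \<subseteq> mingens I
    then \<Sum>m\<in>mingens I - \<tau>. f (insert m \<tau>) * ((- 1) ^ card {m'\<in>insert m \<tau>. idx m' < idx m}
      * monom (mono_lcm (insert m \<tau>) - mono_lcm \<tau>))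
    else 0)"
proof -
  let ?P = "mingens I"
  define t where "t = (\<lambda>\<sigma> m. f \<sigma> * ((- 1) ^ card {m'\<in>\<sigma>. idx m' < idx m}
     * monom (mono_lcm \<sigma> - mono_lcm (\<sigma> - {m}))))"
  have "taylor_diff I idx f \<tau> = (\<Sum>\<sigma>\<in>Pow ?P. \<Sum>m\<in>\<sigma>. if \<tau> = \<sigma> - {m} then t \<sigma> m else 0)"
    by (auto simp: taylor_diff_def taylor_basis_diff_def basis_vector_def t_def sum_distrib_left
        mult.assoc intro!: sum.cong)
  \<comment> \<open>Extending the inner sum to all generators makes its range independent of
    \<open>\<sigma>\<close>, so that the two sums can be swapped.\<close>
  also have "\<dots> = (\<Sum>\<sigma>\<in>Pow ?P. \<Sum>m\<in>?P. if m \<in> \<sigma> then (if \<tau> = \<sigma> - {m} then t \<sigma> m else 0) else 0)"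
  proof (rule sum.cong[OF refl])
    fix \<sigma> assume "\<sigma> \<in> Pow ?P"
    then have "\<sigma> = ?P \<inter> \<sigma>" by blast
    then show "(\<Sum>m\<in>\<sigma>. if \<tau> = \<sigma> - {m} then t \<sigma> m else 0)
        = (\<Sum>m\<in>?P. if m \<in> \<sigma> then (if \<tau> = \<sigma> - {m} then t \<sigma> m else 0) else 0)"
      using sum.inter_restrict[OF fin, of "\<lambda>m. if \<tau> = \<sigma> - {m} then t \<sigma> m else 0" \<sigma>] by simp
  qed
  also have "\<dots> = (\<Sum>m\<in>?P. \<Sum>\<sigma>\<in>Pow ?P. if m \<in> \<sigma> then (if \<tau> = \<sigma> - {m} then t \<sigma> m else 0) else 0)"
    by (rule sum.swap)
  also have "\<dots> = (\<Sum>m\<in>?P. \<Sum>\<sigma>\<in>Pow ?P. if \<sigma> = insert m \<tau> then (if m \<in> \<tau> then 0 else t (insert m \<tau>) m) else 0)"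
    by (intro sum.cong refl) auto
  also have "\<dots> = (\<Sum>m\<in>?P. if \<tau> \<subseteq> ?P then (if m \<notin> \<tau> then t (insert m \<tau>) m else 0) else 0)"
    using fin by (intro sum.cong refl) auto
  also have "\<dots> = (if \<tau> \<subseteq> ?P then \<Sum>m\<in>?P - \<tau>. t (insert m \<tau>) m else 0)"
    using sum.inter_restrict[OF fin, of "\<lambda>m. t (insert m \<tau>) m" "- \<tau>"] by (simp add: Diff_eq)
  also have "\<dots> = (if \<tau> \<subseteq> ?P
    then \<Sum>m\<in>?P - \<tau>. f (insert m \<tau>) * ((- 1) ^ card {m'\<in>insert m \<tau>. idx m' < idx m}
      * monom (mono_lcm (insert m \<tau>) - mono_lcm \<tau>))
    else 0)"
    by (auto simp: t_def intro!: sum.cong)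
  finally show ?thesis .
qed

lemma taylor_diff_empty:
  fixes I :: "('v, 'k::field) mpoly set"
  assumes "finite (mingens I)"
  shows "taylor_diff I idx f {} = (\<Sum>m\<in>mingens I. f {m} * monom m)"
proof -
  have *: "{m'. m' = m \<and> idx m' < idx m} = {}" for m by auto
  show ?thesis using taylor_diff_eq[OF assms, of idx f "{}"] by (simp add: *)
qed

text \<open>The sign of \<open>{m}\<close> in the boundary of \<open>{m, m'}\<close>. The deleted
  element is \<open>m'\<close>, so it is \<open>- 1\<close> exactly when \<open>m\<close> has the
  smaller number.\<close>

definition edge_sign :: "('v mono \<Rightarrow> nat) \<Rightarrow> 'v mono \<Rightarrow> 'v mono \<Rightarrow> ('v, 'k::field) mpoly" where
  "edge_sign idx m m' = (if idx m < idx m' then - 1 else 1)"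

lemma edge_sign_square [simp]: "edge_sign idx m m' * edge_sign idx m m' = 1"
  by (simp add: edge_sign_def)

lemma edge_sign_swap: "idx m \<noteq> idx m' \<Longrightarrow> edge_sign idx m' m = - edge_sign idx m m'"
  by (simp add: edge_sign_def)

lemma taylor_diff_singleton:
  fixes I :: "('v, 'k::field) mpoly set"
  assumes "finite (mingens I)" "m \<in> mingens I"
  shows "taylor_diff I idx f {m}
    = (\<Sum>m'\<in>mingens I - {m}. f {m, m'} * (edge_sign idx m m' * monom (mono_lcm {m, m'} - m)))"
proof -
  have "{m''\<in>{m, m'}. idx m'' < idx m'} = (if idx m < idx m' then {m} else {})" for m'
    by auto
  then have "(- 1 :: ('v, 'k) mpoly) ^ card {m''\<in>{m, m'}. idx m'' < idx m'} = edge_sign idx m m'" for m'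
    by (simp add: edge_sign_def)
  then show ?thesis
    using taylor_diff_eq[OF assms(1), of idx f "{m}"] assms(2)
    by (simp add: insert_commute cong: sum.cong)
qed

lemma taylor_diff_add: "taylor_diff I idx (\<lambda>\<sigma>. f \<sigma> + g \<sigma>) \<tau> = taylor_diff I idx f \<tau> + taylor_diff I idx g \<tau>"
  by (simp add: taylor_diff_def distrib_right sum.distrib)

lemma taylor_diff_diff: "taylor_diff I idx (\<lambda>\<sigma>. f \<sigma> - g \<sigma>) \<tau> = taylor_diff I idx f \<tau> - taylor_diff I idx g \<tau>"
  by (simp add: taylor_diff_def left_diff_distrib sum_subtractf)

lemma taylor_diff_smult: "taylor_diff I idx (\<lambda>\<sigma>. r * f \<sigma>) \<tau> = r * taylor_diff I idx f \<tau>"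
  by (simp add: taylor_diff_def sum_distrib_left mult.assoc)

lemma taylor_diff_zero: "taylor_diff I idx (\<lambda>\<sigma>. 0) \<tau> = 0"
  by (simp add: taylor_diff_def)

lemma taylor_diff_zero_fun: "taylor_diff J idx (\<lambda>_. 0) = (\<lambda>_. 0)"
  by (rule ext) (rule taylor_diff_zero)

text \<open>The boundary of an edge element cancels in pairs; comparing indices instead of summing
  over ordered pairs twice keeps the argument valid in characteristic \<open>2\<close>.\<close>

lemma taylor_diff_taylor_diff_empty:
  fixes I :: "('v, 'k::field) mpoly set"
  assumes fin: "finite (mingens I)" and idx: "inj_on idx (mingens I)"
  shows "taylor_diff I idx (taylor_diff I idx f) {} = 0"
proof -
  let ?P = "mingens I"
  define A where "A = (\<lambda>m m'. if idx m' < idx m then f {m, m'} * monom (mono_lcm {m, m'}) else 0)"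
  have "taylor_diff I idx (taylor_diff I idx f) {} = (\<Sum>m\<in>?P. \<Sum>m'\<in>?P. A m m' - A m' m)"
    unfolding taylor_diff_empty[OF fin]
  proof (rule sum.cong[OF refl])
    fix m assume m: "m \<in> ?P"
    have "taylor_diff I idx f {m} * monom m
        = (\<Sum>m'\<in>?P - {m}. f {m, m'} * edge_sign idx m m' * monom (mono_lcm {m, m'}))"
      unfolding taylor_diff_singleton[OF fin m] sum_distrib_right
      by (intro sum.cong refl)
         (simp add: mult.assoc monom_mult mono_diff_add dvd_mono_lcm)
    also have "\<dots> = (\<Sum>m'\<in>?P - {m}. A m m' - A m' m)"
      by (intro sum.cong refl) (use m idx in \<open>auto simp: A_def edge_sign_def insert_commute inj_on_def\<close>)
    also have "\<dots> = (\<Sum>m'\<in>?P. A m m' - A m' m)"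
      using fin m by (simp add: sum_diff1)
    finally show "taylor_diff I idx f {m} * monom m = (\<Sum>m'\<in>?P. A m m' - A m' m)" .
  qed
  also have "\<dots> = 0"
    by (simp add: sum_subtractf sum.swap[of "\<lambda>m m'. A m' m"])
  finally show ?thesis .
qed

section \<open>Restricting the Taylor differential to free modules on chosen faces\<close>

lemma free_module_carrier_iff:
  assumes "finite B"
  shows "f \<in> carrier (free_module R B)
    \<longleftrightarrow> (\<forall>b\<in>B. f b \<in> carrier R) \<and> (\<forall>b. b \<notin> B \<longrightarrow> f b = \<zero>\<^bsub>R\<^esub>)"
proof -
  have "finite {b. f b \<noteq> \<zero>\<^bsub>R\<^esub>}" if "\<forall>b. b \<notin> B \<longrightarrow> f b = \<zero>\<^bsub>R\<^esub>"
    using that by (intro finite_subset[OF _ assms]) auto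
  then show ?thesis by (auto simp: free_module_def)
qed

lemma free_module_zero: "zero (free_module (poly_ring V) B) = (\<lambda>_. 0)"
  by (simp add: free_module_def)

lemma carrier_free_module_empty: "carrier (free_module (poly_ring V) {}) = {\<lambda>_. 0}"
  by (auto simp: free_module_def)

lemma taylor_diff_carrier:
  fixes I :: "('v, 'k::field) mpoly set"
  assumes fin: "finite (mingens I)" and keys: "\<And>m. m \<in> mingens I \<Longrightarrow> Poly_Mapping.keys m \<subseteq> V"
    and f: "\<And>\<sigma>. f \<sigma> \<in> carrier (poly_ring V)"
  shows "taylor_diff I idx f \<tau> \<in> carrier (poly_ring V)"
proof (cases "\<tau> \<subseteq> mingens I")
  case True
  have "monom (mono_lcm (insert m \<tau>) - mono_lcm \<tau>) \<in> carrier (poly_ring V)" if "m \<in> mingens I" for m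
  proof (rule poly_ring_monom)
    have "finite (insert m \<tau>)" using True fin finite_subset by blast
    then have "Poly_Mapping.keys (mono_lcm (insert m \<tau>)) \<subseteq> V"
      using keys True that by (subst keys_mono_lcm) blast+
    then show "Poly_Mapping.keys (mono_lcm (insert m \<tau>) - mono_lcm \<tau>) \<subseteq> V"
      by (rule order_trans[OF keys_mono_diff])
  qed
  then show ?thesis
    using True f by (subst taylor_diff_eq[OF fin]) (auto intro!: poly_ring_sum poly_ring_mult)
qed (simp add: taylor_diff_eq[OF fin])

text \<open>Linearity is formal; the point is the codomain. By \<open>down\<close>, the coefficient
  at a set outside \<open>B'\<close> collects only values of \<open>f\<close> outside
  \<open>B\<close>, which are zero.\<close>

lemma module_hom_taylor_diff:
  fixes I :: "('v, 'k::field) mpoly set"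
  assumes fin: "finite (mingens I)" and keys: "\<And>m. m \<in> mingens I \<Longrightarrow> Poly_Mapping.keys m \<subseteq> V"
    and B: "finite B" "finite B'"
    and down: "\<And>m \<sigma>. insert m \<sigma> \<in> B \<Longrightarrow> m \<notin> \<sigma> \<Longrightarrow> \<sigma> \<in> B'"
  shows "taylor_diff I idx \<in> module_hom (poly_ring V) (free_module (poly_ring V) B)
    (free_module (poly_ring V) B')"
proof -
  have "taylor_diff I idx f \<in> carrier (free_module (poly_ring V) B')"
    if f: "f \<in> carrier (free_module (poly_ring V) B)" for f :: "_ \<Rightarrow> ('v, 'k) mpoly"
  proof -
    have fR: "f \<sigma> \<in> carrier (poly_ring V)" for \<sigma>
      using f B by (cases "\<sigma> \<in> B") (auto simp: free_module_carrier_iff)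
    have "taylor_diff I idx f \<tau> = 0" if "\<tau> \<notin> B'" for \<tau>
    proof -
      have "f (insert m \<tau>) = 0" if "m \<notin> \<tau>" for m
        using down[of m \<tau>] that f B \<open>\<tau> \<notin> B'\<close> by (auto simp: free_module_carrier_iff)
      then show ?thesis by (auto simp: taylor_diff_eq[OF fin] intro!: sum.neutral)
    qed
    then show ?thesis
      using B taylor_diff_carrier[OF fin keys fR] by (auto simp: free_module_carrier_iff)
  qed
  then show ?thesis
    by (auto simp: module_hom_def free_module_def taylor_diff_add taylor_diff_smult fun_eq_iff)
qed

text \<open>A Scarf face and its facet have different lcms, so their quotient is a monomial other
  than \<open>1\<close> and lies in the irrelevant ideal. Minimality therefore never depends on
  exactness.\<close>

lemma taylor_diff_minimal:
  fixes I :: "('v, 'k::field) mpoly set"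
  assumes fin: "finite (mingens I)" and keys: "\<And>m. m \<in> mingens I \<Longrightarrow> Poly_Mapping.keys m \<subseteq> V"
    and B: "finite B" "B \<subseteq> scarf_complex I"
    and f: "f \<in> carrier (free_module (poly_ring V) B)"
  shows "taylor_diff I idx f \<tau> \<in> irrelevant_ideal V"
proof (cases "\<tau> \<subseteq> mingens I")
  case True
  have "f (insert m \<tau>) * ((- 1) ^ n * monom (mono_lcm (insert m \<tau>) - mono_lcm \<tau>)) \<in> irrelevant_ideal V"
    if m: "m \<in> mingens I" "m \<notin> \<tau>" for m n
  proof (cases "insert m \<tau> \<in> B")
    case True': True
    then have neq: "mono_lcm (insert m \<tau>) \<noteq> mono_lcm \<tau>"
      using B m True by (auto simp: scarf_complex_def)
    have fin': "finite (insert m \<tau>)" using True fin finite_subset by blast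
    then have dvd: "mono_dvd (mono_lcm \<tau>) (mono_lcm (insert m \<tau>))"
      by (rule mono_lcm_subset) blast
    have "mono_lcm (insert m \<tau>) - mono_lcm \<tau> \<noteq> 0"
      using mono_add_diff[OF dvd] neq by auto
    moreover have "Poly_Mapping.keys (mono_lcm (insert m \<tau>)) \<subseteq> V"
      using keys True m(1) fin' by (subst keys_mono_lcm) blast+
    then have "Poly_Mapping.keys (mono_lcm (insert m \<tau>) - mono_lcm \<tau>) \<subseteq> V"
      by (rule order_trans[OF keys_mono_diff])
    ultimately have "monom (mono_lcm (insert m \<tau>) - mono_lcm \<tau>) \<in> irrelevant_ideal V"
      by (rule monom_in_irrelevant_ideal)
    moreover have "f (insert m \<tau>) * (- 1) ^ n \<in> carrier (poly_ring V)"
      using f B(1) True' by (auto simp: free_module_carrier_iff)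
    ultimately show ?thesis
      unfolding irrelevant_ideal_eq mult.assoc[symmetric] by (rule monomial_ideal_mult)
  next
    case False
    then show ?thesis using f B(1) by (simp add: free_module_carrier_iff irrelevant_ideal_eq)
  qed
  then show ?thesis
    using True unfolding irrelevant_ideal_eq
    by (subst taylor_diff_eq[OF fin]) (auto intro!: monomial_ideal_sum)
qed (simp add: taylor_diff_eq[OF fin] irrelevant_ideal_eq)

lemma quotient_module_simps:
  "carrier (quotient_module R I) = a_rcosets\<^bsub>R\<^esub> I"
  "add (quotient_module R I) = (<+>\<^bsub>R\<^esub>)"
  "zero (quotient_module R I) = I"
  "smult (quotient_module R I) = (\<lambda>r X. [mod I:] (I +>\<^bsub>R\<^esub> r) \<Otimes>\<^bsub>R\<^esub> X)"
  by (simp_all add: quotient_module_def ring.defs module.defs FactRing_def ring.extend_def module.fields_def)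

section \<open>Ordered generators\<close>

text \<open>The model is the set of minimal covers ordered by \<open>X\<close>-parts.
  \<open>between\<close> identifies the generators dividing the lcm of a comparable pair with an
  order interval, and \<open>incomparable\<close> makes every other pair redundant.
  \<open>zero_notin_P\<close> keeps the empty set a Scarf face of its own. \<open>bottom\<close> and
  \<open>top\<close> are the common endpoints of the paths that form a cycle.\<close>

locale ordered_generators =
  fixes V :: "'v set" and P :: "'v mono set"
    and le :: "'v mono \<Rightarrow> 'v mono \<Rightarrow> bool" (infix "\<sqsubseteq>" 50)
    and bottom top :: "'v mono"
  assumes finite_P: "finite P"
    and keys_P: "m \<in> P \<Longrightarrow> Poly_Mapping.keys m \<subseteq> V"
    and antichain_P: "m \<in> P \<Longrightarrow> m' \<in> P \<Longrightarrow> mono_dvd m m' \<Longrightarrow> m = m'"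
    and zero_notin_P: "0 \<notin> P"
    and le_refl: "u \<in> P \<Longrightarrow> u \<sqsubseteq> u"
    and le_antisym: "u \<in> P \<Longrightarrow> v \<in> P \<Longrightarrow> u \<sqsubseteq> v \<Longrightarrow> v \<sqsubseteq> u \<Longrightarrow> u = v"
    and le_trans: "u \<in> P \<Longrightarrow> v \<in> P \<Longrightarrow> w \<in> P \<Longrightarrow> u \<sqsubseteq> v \<Longrightarrow> v \<sqsubseteq> w \<Longrightarrow> u \<sqsubseteq> w"
    and between: "u \<in> P \<Longrightarrow> v \<in> P \<Longrightarrow> w \<in> P \<Longrightarrow> u \<sqsubseteq> w
      \<Longrightarrow> mono_dvd v (mono_lcm {u, w}) \<longleftrightarrow> u \<sqsubseteq> v \<and> v \<sqsubseteq> w"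
    and incomparable: "u \<in> P \<Longrightarrow> v \<in> P \<Longrightarrow> \<not> u \<sqsubseteq> v \<Longrightarrow> \<not> v \<sqsubseteq> u
      \<Longrightarrow> \<exists>w\<in>P. w \<noteq> u \<and> w \<noteq> v \<and> mono_dvd w (mono_lcm {u, v})"
    and bottom: "bottom \<in> P" "u \<in> P \<Longrightarrow> bottom \<sqsubseteq> u"
    and top: "top \<in> P" "u \<in> P \<Longrightarrow> u \<sqsubseteq> top"
begin

abbreviation I :: "('v, 'k::field) mpoly set" where
  "I \<equiv> monomial_ideal V P"

lemma mingens_I [simp]: "mingens (I :: ('v, 'k::field) mpoly set) = P"
  by (rule mingens_monomial_ideal) (use keys_P antichain_P in auto)

text \<open>The covering relation of the order: \<open>v\<close> is an immediate successor of
  \<open>u\<close>. It has nothing to do with vertex covers.\<close>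

definition covers :: "'v mono \<Rightarrow> 'v mono \<Rightarrow> bool" where
  "covers u v \<longleftrightarrow> u \<in> P \<and> v \<in> P \<and> u \<noteq> v \<and> u \<sqsubseteq> v
    \<and> (\<forall>w\<in>P. u \<sqsubseteq> w \<and> w \<sqsubseteq> v \<longrightarrow> w = u \<or> w = v)"

lemma finite_subset_P: "\<sigma> \<subseteq> P \<Longrightarrow> finite \<sigma>"
  using finite_P finite_subset by blast

text \<open>Since \<open>w\<close> divides the lcm of the rest, toggling its membership in
  \<open>\<sigma>\<close> leaves the lcm unchanged, so \<open>\<sigma>\<close> shares its lcm with
  another set.\<close>

lemma scarf_no_redundant:
  assumes \<sigma>: "\<sigma> \<in> scarf_complex (I :: ('v, 'k::field) mpoly set)" and S: "S \<subseteq> \<sigma>"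
    and w: "w \<in> P" "w \<notin> S" "mono_dvd w (mono_lcm S)"
  shows False
proof -
  have \<sigma>P: "\<sigma> \<subseteq> P" using \<sigma> by (simp add: scarf_complex_def)
  have fin: "finite \<sigma>" using finite_subset_P[OF \<sigma>P] .
  have uniq: "mono_lcm \<tau> \<noteq> mono_lcm \<sigma>" if "\<tau> \<subseteq> P" "\<tau> \<noteq> \<sigma>" for \<tau>
  proof -
    have "\<forall>\<tau>. \<tau> \<subseteq> P \<and> \<tau> \<noteq> \<sigma> \<longrightarrow> mono_lcm \<sigma> \<noteq> mono_lcm \<tau>"
      using \<sigma> unfolding scarf_complex_def mingens_I by (rule CollectE) (erule conjE)
    then show ?thesis using that by metis
  qed
  \<comment> \<open>As \<open>w\<close> is not in \<open>S\<close>, the set \<open>S\<close>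
    survives in \<open>\<sigma> - {w}\<close>; this treats the cases of \<open>w\<close> inside and
    outside \<open>\<sigma>\<close> alike.\<close>
  have dvd: "mono_dvd w (mono_lcm (\<sigma> - {w}))"
    using S w fin by (intro mono_dvd_trans[OF w(3) mono_lcm_subset]) auto
  have "mono_lcm (insert w (\<sigma> - {w})) = mono_lcm (\<sigma> - {w})"
    using fin dvd by (intro mono_lcm_insert) auto
  then have eq: "mono_lcm (insert w \<sigma>) = mono_lcm (\<sigma> - {w})" by simp
  show False
  proof (cases "w \<in> \<sigma>")
    case True
    moreover from this have "\<sigma> - {w} \<subseteq> P" "\<sigma> - {w} \<noteq> \<sigma>" using \<sigma>P by blast+
    ultimately show False using uniq[of "\<sigma> - {w}"] eq by (simp add: insert_absorb)
  next
    case False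
    moreover from this have "insert w \<sigma> \<subseteq> P" "insert w \<sigma> \<noteq> \<sigma>" using \<sigma>P w(1) by blast+
    ultimately show False using uniq[of "insert w \<sigma>"] eq by simp
  qed
qed

text \<open>A face is a chain by \<open>incomparable\<close>, and by \<open>between\<close> it
  leaves no generator strictly inside. Conversely only \<open>u\<close> and \<open>v\<close> divide
  the lcm of a covering pair, and by the antichain property neither can be omitted.\<close>

lemma scarf_complex_iff:
  "\<sigma> \<in> scarf_complex (I :: ('v, 'k::field) mpoly set)
    \<longleftrightarrow> \<sigma> = {} \<or> (\<exists>m\<in>P. \<sigma> = {m}) \<or> (\<exists>u v. covers u v \<and> \<sigma> = {u, v})"
proof
  assume \<sigma>: "\<sigma> \<in> scarf_complex (I :: ('v, 'k) mpoly set)"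
  then have \<sigma>P: "\<sigma> \<subseteq> P" by (simp add: scarf_complex_def)
  have comp: "u \<sqsubseteq> v \<or> v \<sqsubseteq> u" if "u \<in> \<sigma>" "v \<in> \<sigma>" for u v
    using scarf_no_redundant[OF \<sigma>, of "{u, v}"] incomparable[of u v] that \<sigma>P by blast
  have gap: "w = u \<or> w = v" if "u \<in> \<sigma>" "v \<in> \<sigma>" "w \<in> P" "u \<sqsubseteq> w" "w \<sqsubseteq> v" for u v w
  proof (rule ccontr)
    assume "\<not> (w = u \<or> w = v)"
    moreover have "mono_dvd w (mono_lcm {u, v})"
      using between[of u w v] le_trans[of u w v] that \<sigma>P by blast
    ultimately show False
      using scarf_no_redundant[OF \<sigma>, of "{u, v}" w] that by blast
  qed
  \<comment> \<open>Of three comparable elements one lies between the other two, which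
    \<open>gap\<close> forbids.\<close>
  have two: "w = u \<or> w = v" if "u \<in> \<sigma>" "v \<in> \<sigma>" "w \<in> \<sigma>" "u \<noteq> v" for u v w
    using gap comp that \<sigma>P by (metis subsetD)
  show "\<sigma> = {} \<or> (\<exists>m\<in>P. \<sigma> = {m}) \<or> (\<exists>u v. covers u v \<and> \<sigma> = {u, v})"
  proof (cases "\<exists>u\<in>\<sigma>. \<exists>v\<in>\<sigma>. u \<noteq> v")
    case True
    then obtain u v where uv: "u \<in> \<sigma>" "v \<in> \<sigma>" "u \<noteq> v" "u \<sqsubseteq> v" using comp by metis
    then have "\<sigma> = {u, v}" using two by blast
    moreover have "covers u v" unfolding covers_def using uv gap \<sigma>P by blast
    ultimately show ?thesis by blast
  next
    case False
    then have "\<sigma> = {} \<or> (\<exists>m\<in>\<sigma>. \<sigma> = {m})" by blast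
    then show ?thesis using \<sigma>P by blast
  qed
next
  assume "\<sigma> = {} \<or> (\<exists>m\<in>P. \<sigma> = {m}) \<or> (\<exists>u v. covers u v \<and> \<sigma> = {u, v})"
  then consider "\<sigma> = {}" | m where "m \<in> P" "\<sigma> = {m}" | u v where "covers u v" "\<sigma> = {u, v}"
    by blast
  then have "\<sigma> \<subseteq> P \<and> (\<forall>\<tau>. \<tau> \<subseteq> P \<and> mono_lcm \<tau> = mono_lcm \<sigma> \<longrightarrow> \<tau> = \<sigma>)"
  proof cases
    case 1
    have "\<tau> = {}" if \<tau>: "\<tau> \<subseteq> P" "mono_lcm \<tau> = 0" for \<tau>
    proof (rule ccontr)
      assume "\<tau> \<noteq> {}"
      then obtain m where m: "m \<in> \<tau>" by blast
      have "mono_dvd m 0" using dvd_mono_lcm[OF finite_subset_P[OF \<tau>(1)] m] \<tau>(2) by simp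
      then show False using m \<tau>(1) zero_notin_P by auto
    qed
    then show ?thesis using 1 by simp
  next
    case (2 m)
    have "\<tau> = {m}" if \<tau>: "\<tau> \<subseteq> P" "mono_lcm \<tau> = m" for \<tau>
    proof -
      have "t = m" if "t \<in> \<tau>" for t
        using antichain_P[of t m] dvd_mono_lcm[OF finite_subset_P[OF \<tau>(1)] that] \<tau> that 2 by auto
      moreover have "\<tau> \<noteq> {}" using \<tau> 2 zero_notin_P by auto
      ultimately show ?thesis by blast
    qed
    then show ?thesis using 2 by simp
  next
    case (3 u v)
    have uv: "u \<in> P" "v \<in> P" "u \<noteq> v" "u \<sqsubseteq> v" using 3 by (auto simp: covers_def)
    have "\<tau> = {u, v}" if \<tau>: "\<tau> \<subseteq> P" "mono_lcm \<tau> = mono_lcm {u, v}" for \<tau>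
    proof -
      have fin: "finite \<tau>" using finite_subset_P[OF \<tau>(1)] .
      have sub: "\<tau> \<subseteq> {u, v}"
      proof
        fix t assume t: "t \<in> \<tau>"
        then have "mono_dvd t (mono_lcm {u, v})" using dvd_mono_lcm[OF fin t] \<tau>(2) by simp
        then show "t \<in> {u, v}"
          using between[of u t v] uv t \<tau>(1) 3(1) unfolding covers_def by blast
      qed
      \<comment> \<open>If \<open>b\<close> were missing from \<open>\<tau>\<close>, it would divide
        an lcm dividing \<open>a\<close>, against the antichain property.\<close>
      have *: False if "\<tau> \<subseteq> {a}" "b \<in> {u, v}" "a \<in> {u, v}" "a \<noteq> b" for a b
      proof -
        have "mono_dvd b (mono_lcm \<tau>)" using \<tau>(2) that(2) dvd_mono_lcm[of "{u, v}" b] by simp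
        also have "mono_dvd (mono_lcm \<tau>) a"
          using mono_lcm_subset[OF _ that(1)] by simp
        finally show False using antichain_P[of b a] that uv by blast
      qed
      have "\<tau> = {u, v}" if "u \<in> \<tau>" "v \<in> \<tau>" using sub that by blast
      moreover have False if "u \<notin> \<tau>" using *[of v u] sub that uv by blast
      moreover have False if "v \<notin> \<tau>" using *[of u v] sub that uv by blast
      ultimately show ?thesis by blast
    qed
    then show ?thesis using 3 uv by simp
  qed
  then show "\<sigma> \<in> scarf_complex (I :: ('v, 'k) mpoly set)"
    unfolding scarf_complex_def mingens_I by fastforce
qed

definition edges :: "'v mono set set" where
  "edges = {{u, v} | u v. covers u v}"

lemma card_covers: "covers u v \<Longrightarrow> card {u, v} = 2"
  by (auto simp: covers_def)

lemma faces_0: "{\<sigma> \<in> scarf_complex (I :: ('v, 'k::field) mpoly set). card \<sigma> = 0} = {{}}"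
  by (auto simp: scarf_complex_iff card_covers dest: card_covers)

lemma faces_1:
  "{\<sigma> \<in> scarf_complex (I :: ('v, 'k::field) mpoly set). card \<sigma> = Suc 0} = (\<lambda>m. {m}) ` P"
  by (auto simp: scarf_complex_iff dest: card_covers)

lemma faces_2:
  "{\<sigma> \<in> scarf_complex (I :: ('v, 'k::field) mpoly set). card \<sigma> = Suc (Suc 0)} = edges"
  by (auto simp: scarf_complex_iff edges_def dest: card_covers)

text \<open>The third and all later modules vanish, so exactness at the edges means injectivity of
  the differential there. The iterated \<open>Suc\<close> matches the index shifts in
  \<open>free_resolution\<close>.\<close>

lemma faces_ge_3:
  "{\<sigma> \<in> scarf_complex (I :: ('v, 'k::field) mpoly set). card \<sigma> = Suc (Suc (Suc i))} = {}"
  by (auto simp: scarf_complex_iff dest: card_covers)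

lemma finite_scarf_complex: "finite (scarf_complex (I :: ('v, 'k::field) mpoly set))"
  by (rule finite_subset[of _ "Pow P"]) (auto simp: scarf_complex_def finite_P)

lemma finite_edges: "finite edges"
  by (rule finite_subset[of _ "Pow P"]) (auto simp: edges_def covers_def finite_P)

text \<open>This closure under facets is what lets the Taylor differential restrict to the Scarf
  faces.\<close>

lemma scarf_complex_remove:
  assumes "insert m \<sigma> \<in> scarf_complex (I :: ('v, 'k::field) mpoly set)" "m \<notin> \<sigma>"
  shows "\<sigma> \<in> scarf_complex (I :: ('v, 'k) mpoly set)"
proof -
  consider "insert m \<sigma> = {m}" "m \<in> P" | u v where "covers u v" "insert m \<sigma> = {u, v}"
    using assms(1) unfolding scarf_complex_iff by blast
  then have "\<sigma> = {} \<or> (\<exists>m\<in>P. \<sigma> = {m})"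
  proof cases
    case 1
    then show ?thesis using assms(2) by blast
  next
    case (2 u v)
    have "\<sigma> = insert m \<sigma> - {m}" using assms(2) by simp
    then have "\<sigma> = {u, v} - {m}" using 2(2) by simp
    moreover have "m \<in> {u, v}" using 2(2) by blast
    moreover have "u \<in> P" "v \<in> P" "u \<noteq> v" using 2(1) by (simp_all add: covers_def)
    ultimately show ?thesis by auto
  qed
  then show ?thesis by (auto simp: scarf_complex_iff)
qed

text \<open>The size of the principal down-set is strictly monotone even if the order is not graded.
  It serves as an induction measure and for choosing maximal elements.\<close>

definition rank :: "'v mono \<Rightarrow> nat" where
  "rank w = card {z \<in> P. z \<sqsubseteq> w}"

lemma rank_less:
  assumes "u \<in> P" "v \<in> P" "u \<sqsubseteq> v" "u \<noteq> v"
  shows "rank u < rank v"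
  unfolding rank_def
proof (rule psubset_card_mono)
  show "finite {z \<in> P. z \<sqsubseteq> v}" using finite_P by simp
  have "{z \<in> P. z \<sqsubseteq> u} \<subseteq> {z \<in> P. z \<sqsubseteq> v}" using assms le_trans by blast
  moreover have "v \<in> {z \<in> P. z \<sqsubseteq> v}" "v \<notin> {z \<in> P. z \<sqsubseteq> u}"
    using assms le_refl le_antisym by auto
  ultimately show "{z \<in> P. z \<sqsubseteq> u} \<subset> {z \<in> P. z \<sqsubseteq> v}" by blast
qed

lemma ex_max_rank:
  assumes "S \<subseteq> P" "S \<noteq> {}"
  shows "\<exists>v\<in>S. \<forall>w\<in>S. rank w \<le> rank v"
proof -
  have fin: "finite (rank ` S)" using finite_subset_P[OF assms(1)] by simp
  have "Max (rank ` S) \<in> rank ` S" using fin assms(2) by (intro Max_in) auto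
  then obtain v where "v \<in> S" "rank v = Max (rank ` S)" by auto
  then show ?thesis using fin by (auto intro!: bexI[of _ v])
qed

lemma ex_covers:
  assumes x: "x \<in> P" "x \<noteq> bottom"
  shows "\<exists>y. covers y x"
proof -
  let ?S = "{w \<in> P. w \<sqsubseteq> x \<and> w \<noteq> x}"
  \<comment> \<open>An element of largest rank strictly below \<open>x\<close> admits nothing
    between itself and \<open>x\<close>.\<close>
  have "bottom \<in> ?S" using x bottom by auto
  then obtain y where y: "y \<in> ?S" "\<forall>w\<in>?S. rank w \<le> rank y"
    using ex_max_rank[of ?S] by blast
  have "w = y \<or> w = x" if "w \<in> P" "y \<sqsubseteq> w" "w \<sqsubseteq> x" for w
    using y that rank_less[of y w] by fastforce
  then show ?thesis using x y unfolding covers_def by blast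
qed

section \<open>Chains of edges in the Hasse diagram\<close>

lemma edges_subset_P: "\<sigma> \<in> edges \<Longrightarrow> \<sigma> \<subseteq> P"
  by (auto simp: edges_def covers_def)

lemma edges_carrier_iff:
  "c \<in> carrier (free_module (poly_ring V) edges)
    \<longleftrightarrow> (\<forall>\<sigma>\<in>edges. c \<sigma> \<in> carrier (poly_ring V)) \<and> (\<forall>\<sigma>. \<sigma> \<notin> edges \<longrightarrow> c \<sigma> = 0)"
  by (simp add: free_module_carrier_iff finite_edges)

text \<open>The built-in sign orients the edge from \<open>u\<close> to \<open>v\<close>: whatever
  the numbering, its boundary has a positive coefficient at \<open>v\<close> and a negative one at
  \<open>u\<close>.\<close>

definition edge_chain ::
  "('v mono \<Rightarrow> nat) \<Rightarrow> 'v mono \<Rightarrow> 'v mono \<Rightarrow> ('v, 'k::field) mpoly \<Rightarrow> 'v mono set \<Rightarrow> ('v, 'k) mpoly"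
  where "edge_chain idx u v p = (\<lambda>\<sigma>. if \<sigma> = {u, v} then edge_sign idx v u * p else 0)"

lemma edge_chain_carrier:
  assumes "covers u v" "p \<in> carrier (poly_ring V)"
  shows "edge_chain idx u v p \<in> carrier (free_module (poly_ring V) edges)"
proof -
  have "{u, v} \<in> edges" using assms(1) by (auto simp: edges_def)
  moreover have "edge_sign idx v u * p \<in> carrier (poly_ring V)"
    using assms(2) by (auto simp: edge_sign_def)
  ultimately show ?thesis by (auto simp: edges_carrier_iff edge_chain_def)
qed

text \<open>At \<open>v\<close> the built-in sign meets itself and squares to one. At
  \<open>u\<close> it meets the opposite sign, because distinct generators have distinct
  numbers.\<close>

lemma taylor_diff_edge_chain:
  fixes p :: "('v, 'k::field) mpoly"
  assumes idx: "inj_on idx P" and uv: "covers u v" and m: "m \<in> P"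
  shows "taylor_diff (I :: ('v, 'k) mpoly set) idx (edge_chain idx u v p) {m}
    = (if m = v then p * monom (mono_lcm {u, v} - v) else 0)
      - (if m = u then p * monom (mono_lcm {u, v} - u) else 0)"
proof -
  have P: "u \<in> P" "v \<in> P" "u \<noteq> v" using uv by (auto simp: covers_def)
  have eq: "taylor_diff (I :: ('v, 'k) mpoly set) idx (edge_chain idx u v p) {m}
    = (\<Sum>m'\<in>P - {m}. edge_chain idx u v p {m, m'} * (edge_sign idx m m' * monom (mono_lcm {m, m'} - m)))"
    using taylor_diff_singleton[of "I :: ('v, 'k) mpoly set" m idx] finite_P m by simp
  consider "m = v" | "m = u" | "m \<noteq> u" "m \<noteq> v" by blast
  then show ?thesis
  proof cases
    case 1
    have "edge_chain idx u v p {m, m'} * (edge_sign idx m m' * monom (mono_lcm {m, m'} - m))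
        = (if m' = u then p * monom (mono_lcm {u, v} - v) else 0)" for m'
    proof (cases "m' = u")
      case True
      have "edge_chain idx u v p {m, m'} * (edge_sign idx m m' * monom (mono_lcm {m, m'} - m))
          = (edge_sign idx v u * edge_sign idx v u) * (p * monom (mono_lcm {u, v} - v))"
        using 1 True by (simp only: edge_chain_def insert_commute[of v u] if_True refl mult_ac)
      then show ?thesis using True by simp
    qed (use 1 P in \<open>auto simp: edge_chain_def doubleton_eq_iff\<close>)
    then show ?thesis unfolding eq using 1 P finite_P by simp
  next
    case 2
    have sw: "edge_sign idx u v = (- edge_sign idx v u :: ('v, 'k) mpoly)"
      using idx P by (intro edge_sign_swap) (auto simp: inj_on_def)
    have "edge_chain idx u v p {m, m'} * (edge_sign idx m m' * monom (mono_lcm {m, m'} - m))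
        = (if m' = v then - (p * monom (mono_lcm {u, v} - u)) else 0)" for m'
    proof (cases "m' = v")
      case True
      have "edge_chain idx u v p {m, m'} * (edge_sign idx m m' * monom (mono_lcm {m, m'} - m))
          = - ((edge_sign idx v u * edge_sign idx v u) * (p * monom (mono_lcm {u, v} - u)))"
        using 2 True sw by (simp only: edge_chain_def if_True refl mult_ac mult_minus_left mult_minus_right)
      then show ?thesis using True by simp
    qed (use 2 P in \<open>auto simp: edge_chain_def doubleton_eq_iff\<close>)
    then show ?thesis unfolding eq using 2 P finite_P by simp
  next
    case 3
    then have "edge_chain idx u v p {m, m'} = 0" for m'
      by (auto simp: edge_chain_def doubleton_eq_iff)
    then show ?thesis unfolding eq using 3 by simp
  qed
qed

lemma mono_lcm_P_dvd: "\<sigma> \<subseteq> P \<Longrightarrow> mono_dvd (mono_lcm \<sigma>) (mono_lcm P)"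
  using finite_P by (rule mono_lcm_subset)

lemma keys_lcm_diff: "\<sigma> \<subseteq> P \<Longrightarrow> Poly_Mapping.keys (mono_lcm \<sigma> - m) \<subseteq> V"
  by (rule order_trans[OF keys_mono_diff]) (use keys_P in \<open>auto simp: keys_mono_lcm finite_subset_P\<close>)

text \<open>A saturated path from \<open>u\<close> to \<open>v\<close>, homogenized to the degree \<open>mono_lcm P\<close>.\<close>

lemma ex_path_chain:
  assumes idx: "inj_on idx P" and "u \<in> P" "v \<in> P" "u \<sqsubseteq> v"
  shows "\<exists>c :: 'v mono set \<Rightarrow> ('v, 'k::field) mpoly. c \<in> carrier (free_module (poly_ring V) edges)
    \<and> (\<forall>m\<in>P. taylor_diff (I :: ('v, 'k) mpoly set) idx c {m}
        = (if m = v then monom (mono_lcm P - v) else 0) - (if m = u then monom (mono_lcm P - u) else 0))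
    \<and> (\<forall>\<sigma>. c \<sigma> \<noteq> 0 \<longrightarrow> (\<forall>w\<in>\<sigma>. u \<sqsubseteq> w \<and> w \<sqsubseteq> v))"
  using assms(2-4)
proof (induction "rank v - rank u" arbitrary: u v rule: less_induct)
  case less
  consider "u = v" | "covers u v" | w where "w \<in> P" "u \<sqsubseteq> w" "w \<sqsubseteq> v" "w \<noteq> u" "w \<noteq> v"
    using less.prems unfolding covers_def by blast
  then show ?case
  proof cases
    case 1
    then show ?thesis
      by (intro exI[of _ "\<lambda>_. 0"]) (simp add: edges_carrier_iff taylor_diff_zero)
  next
    case 2
    \<comment> \<open>This factor completes the lcm of the edge to the lcm of all generators, so the
      coefficient at an endpoint \<open>w\<close> is \<open>monom (mono_lcm P - w)\<close>,
      independently of the edge.\<close>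
    let ?p = "monom (mono_lcm P - mono_lcm {u, v}) :: ('v, 'k) mpoly"
    have uvP: "{u, v} \<subseteq> P" using less.prems by simp
    have "?p * monom (mono_lcm {u, v} - w) = monom (mono_lcm P - w)" if "w \<in> {u, v}" for w
      using dvd_mono_lcm[of "{u, v}" w] mono_lcm_P_dvd[OF uvP] that
      by (simp add: monom_mult mono_diff_telescope)
    then have "\<forall>m\<in>P. taylor_diff (I :: ('v, 'k) mpoly set) idx (edge_chain idx u v ?p) {m}
        = (if m = v then monom (mono_lcm P - v) else 0) - (if m = u then monom (mono_lcm P - u) else 0)"
      by (simp add: taylor_diff_edge_chain[OF idx 2])
    moreover have "edge_chain idx u v ?p \<in> carrier (free_module (poly_ring V) edges)"
      by (rule edge_chain_carrier[OF 2 poly_ring_monom[OF keys_lcm_diff]]) simp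
    moreover have "\<forall>w\<in>\<sigma>. u \<sqsubseteq> w \<and> w \<sqsubseteq> v" if "edge_chain idx u v ?p \<sigma> \<noteq> 0" for \<sigma>
      using that less.prems le_refl by (auto simp: edge_chain_def split: if_splits)
    ultimately show ?thesis by blast
  next
    case (3 w)
    \<comment> \<open>Both strict inequalities enter, since the measure is a truncated difference
      and each half of the path must be shorter.\<close>
    have "rank u < rank w" "rank w < rank v" using 3 less.prems rank_less by auto
    then have r: "rank u < rank w" "rank w < rank v"
      "rank w - rank u < rank v - rank u" "rank v - rank w < rank v - rank u" by auto
    obtain c where c: "c \<in> carrier (free_module (poly_ring V) edges)"
      "\<forall>m\<in>P. taylor_diff (I :: ('v, 'k) mpoly set) idx c {m}
        = (if m = w then monom (mono_lcm P - w) else 0) - (if m = u then monom (mono_lcm P - u) else 0)"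
      "\<forall>\<sigma>. c \<sigma> \<noteq> 0 \<longrightarrow> (\<forall>x\<in>\<sigma>. u \<sqsubseteq> x \<and> x \<sqsubseteq> w)"
      using less.hyps[OF r(3) less.prems(1) 3(1,2)] by blast
    obtain d where d: "d \<in> carrier (free_module (poly_ring V) edges)"
      "\<forall>m\<in>P. taylor_diff (I :: ('v, 'k) mpoly set) idx d {m}
        = (if m = v then monom (mono_lcm P - v) else 0) - (if m = w then monom (mono_lcm P - w) else 0)"
      "\<forall>\<sigma>. d \<sigma> \<noteq> 0 \<longrightarrow> (\<forall>x\<in>\<sigma>. w \<sqsubseteq> x \<and> x \<sqsubseteq> v)"
      using less.hyps[OF r(4) 3(1) less.prems(2) 3(3)] by blast
    have "u \<sqsubseteq> x \<and> x \<sqsubseteq> v" if "c \<sigma> + d \<sigma> \<noteq> 0" "x \<in> \<sigma>" for \<sigma> x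
    proof -
      have nz: "c \<sigma> \<noteq> 0 \<or> d \<sigma> \<noteq> 0" using that(1) by auto
      then have "\<sigma> \<in> edges" using c(1) d(1) unfolding edges_carrier_iff by blast
      then have "x \<in> P" using that(2) edges_subset_P by blast
      then show ?thesis
        using nz that(2) c(3) d(3) le_trans[of u w x] le_trans[of x w v] 3 less.prems by blast
    qed
    moreover have "(\<lambda>\<sigma>. c \<sigma> + d \<sigma>) \<in> carrier (free_module (poly_ring V) edges)"
      using c(1) d(1) by (auto simp: edges_carrier_iff)
    ultimately show ?thesis
      using c(2) d(2) by (intro exI[of _ "\<lambda>\<sigma>. c \<sigma> + d \<sigma>"]) (auto simp: taylor_diff_add)
  qed
qed

text \<open>Two saturated paths from \<open>bottom\<close> to \<open>top\<close> have the same boundary, so they coincide.\<close>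

lemma total_if_injective:
  assumes idx: "inj_on idx P"
    and inj: "\<And>c. c \<in> carrier (free_module (poly_ring V) edges)
      \<Longrightarrow> (\<forall>m\<in>P. taylor_diff (I :: ('v, 'k::field) mpoly set) idx c {m} = 0) \<Longrightarrow> c = (\<lambda>_. 0)"
    and u: "u \<in> P" and v: "v \<in> P"
  shows "u \<sqsubseteq> v \<or> v \<sqsubseteq> u"
proof (rule ccontr)
  assume inc: "\<not> (u \<sqsubseteq> v \<or> v \<sqsubseteq> u)"
  let ?d = "taylor_diff (I :: ('v, 'k) mpoly set) idx"
  let ?M = "\<lambda>w m. if m = w then monom (mono_lcm P - w) else (0 :: ('v, 'k) mpoly)"
  let ?F = "carrier (free_module (poly_ring V) edges)"
  obtain c1 where c1: "c1 \<in> ?F" "\<forall>m\<in>P. ?d c1 {m} = ?M u m - ?M bottom m"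
    "\<forall>\<sigma>. c1 \<sigma> \<noteq> 0 \<longrightarrow> (\<forall>w\<in>\<sigma>. bottom \<sqsubseteq> w \<and> w \<sqsubseteq> u)"
    using ex_path_chain[OF idx bottom(1) u bottom(2)[OF u]] by blast
  obtain c2 where c2: "c2 \<in> ?F" "\<forall>m\<in>P. ?d c2 {m} = ?M top m - ?M u m"
    "\<forall>\<sigma>. c2 \<sigma> \<noteq> 0 \<longrightarrow> (\<forall>w\<in>\<sigma>. u \<sqsubseteq> w \<and> w \<sqsubseteq> top)"
    using ex_path_chain[OF idx u top(1) top(2)[OF u]] by blast
  obtain d1 where d1: "d1 \<in> ?F" "\<forall>m\<in>P. ?d d1 {m} = ?M v m - ?M bottom m"
    "\<forall>\<sigma>. d1 \<sigma> \<noteq> 0 \<longrightarrow> (\<forall>w\<in>\<sigma>. bottom \<sqsubseteq> w \<and> w \<sqsubseteq> v)"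
    using ex_path_chain[OF idx bottom(1) v bottom(2)[OF v]] by blast
  obtain d2 where d2: "d2 \<in> ?F" "\<forall>m\<in>P. ?d d2 {m} = ?M top m - ?M v m"
    "\<forall>\<sigma>. d2 \<sigma> \<noteq> 0 \<longrightarrow> (\<forall>w\<in>\<sigma>. v \<sqsubseteq> w \<and> w \<sqsubseteq> top)"
    using ex_path_chain[OF idx v top(1) top(2)[OF v]] by blast
  \<comment> \<open>The cycle runs up through \<open>u\<close> and back down through
    \<open>v\<close>; the boundaries at \<open>u\<close>, \<open>v\<close>, \<open>bottom\<close>
    and \<open>top\<close> cancel.\<close>
  let ?c = "\<lambda>\<sigma>. (c1 \<sigma> + c2 \<sigma>) - (d1 \<sigma> + d2 \<sigma>)"
  have "?c \<in> ?F"
    using c1(1) c2(1) d1(1) d2(1)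
    by (auto simp: edges_carrier_iff intro!: poly_ring_diff poly_ring_add)
  moreover have "\<forall>m\<in>P. ?d ?c {m} = 0"
    using c1(2) c2(2) d1(2) d2(2) by (simp add: taylor_diff_add taylor_diff_diff)
  ultimately have "?c = (\<lambda>_. 0)" by (rule inj)
  then have eq: "c1 \<sigma> + c2 \<sigma> = d1 \<sigma> + d2 \<sigma>" for \<sigma>
    by (simp add: fun_eq_iff)
  \<comment> \<open>The paths through \<open>v\<close> avoid \<open>u\<close>, since an edge at
    \<open>u\<close> would make \<open>u\<close> and \<open>v\<close> comparable. So an edge of
    \<open>c1\<close> at \<open>u\<close> must be cancelled by \<open>c2\<close>; but it would then
    lie both below and above \<open>u\<close>, leaving only one possible vertex.\<close>
  have c1_zero: "c1 \<sigma> = 0" if "u \<in> \<sigma>" for \<sigma>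
  proof (rule ccontr)
    assume nz: "c1 \<sigma> \<noteq> 0"
    have "d1 \<sigma> = 0" "d2 \<sigma> = 0" using d1(3) d2(3) inc that by blast+
    then have "c2 \<sigma> \<noteq> 0" using eq[of \<sigma>] nz by auto
    have "\<sigma> \<in> edges" using c1(1) nz unfolding edges_carrier_iff by blast
    then obtain x y where xy: "\<sigma> = {x, y}" "x \<in> P" "y \<in> P" "x \<noteq> y"
      by (auto simp: edges_def covers_def)
    have "w = u" if "w \<in> \<sigma>" for w
      using le_antisym[of w u] c1(3) c2(3) nz \<open>c2 \<sigma> \<noteq> 0\<close> that xy u by blast
    then show False using xy by blast
  qed
  \<comment> \<open>Without edges at \<open>u\<close> the path cannot have the nonzero boundary
    prescribed at its endpoint \<open>u\<close>.\<close>
  have "?d c1 {u} = 0"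
    using taylor_diff_singleton[of "I :: ('v, 'k) mpoly set" u idx c1] finite_P u
    by (simp add: c1_zero)
  moreover have "u \<noteq> bottom" using inc bottom(2)[OF v] by blast
  ultimately show False using c1(2) u by simp
qed

section \<open>Exactness when the order is total\<close>

lemma finite_mingens_I: "finite (mingens (I :: ('v, 'k::field) mpoly set))"
  by (simp add: finite_P)

lemma covers_pred_unique:
  assumes "covers u v" "covers u' v" "u \<sqsubseteq> u' \<or> u' \<sqsubseteq> u"
  shows "u = u'"
  using assms unfolding covers_def by blast

text \<open>In a total order each element has at most one predecessor. At the upper end of the
  highest edge carrying a nonzero coefficient nothing can cancel: the boundary there is, up to sign,
  that coefficient times a monomial.\<close>

lemma injective_if_total:
  fixes c :: "'v mono set \<Rightarrow> ('v, 'k::field) mpoly"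
  assumes total: "\<And>u v. u \<in> P \<Longrightarrow> v \<in> P \<Longrightarrow> u \<sqsubseteq> v \<or> v \<sqsubseteq> u"
    and c: "c \<in> carrier (free_module (poly_ring V) edges)"
    and ker: "\<And>m. m \<in> P \<Longrightarrow> taylor_diff (I :: ('v, 'k) mpoly set) idx c {m} = 0"
  shows "c = (\<lambda>_. 0)"
proof (rule ccontr)
  assume "c \<noteq> (\<lambda>_. 0)"
  then obtain \<sigma> where \<sigma>: "c \<sigma> \<noteq> 0" by auto
  have edge: "covers x y \<or> covers y x" if "c {x, y} \<noteq> 0" for x y
  proof -
    have "{x, y} \<in> edges" using c that unfolding edges_carrier_iff by blast
    then obtain u v where "covers u v" "{x, y} = {u, v}" unfolding edges_def by blast
    then show ?thesis by (auto simp: doubleton_eq_iff)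
  qed
  let ?S = "{v \<in> P. \<exists>u. covers u v \<and> c {u, v} \<noteq> 0}"
  obtain x y where xy: "\<sigma> = {x, y}" "covers x y"
  proof -
    have "\<sigma> \<in> edges" using c \<sigma> unfolding edges_carrier_iff by blast
    then show ?thesis using that unfolding edges_def by blast
  qed
  have "y \<in> ?S" using \<sigma> xy by (auto simp: covers_def)
  then obtain v where v: "v \<in> ?S" "\<forall>w\<in>?S. rank w \<le> rank v"
    using ex_max_rank[of ?S] by blast
  then obtain u where u: "covers u v" "c {u, v} \<noteq> 0" by blast
  have uv: "u \<in> P" "v \<in> P" "u \<noteq> v" using u by (auto simp: covers_def)
  \<comment> \<open>Another such edge would either go up, contradicting the maximal rank of
    \<open>v\<close>, or come from a second predecessor of \<open>v\<close>.\<close>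
  have "c {v, m} = 0" if m: "m \<noteq> u" for m
  proof (rule ccontr)
    assume nz: "c {v, m} \<noteq> 0"
    consider "covers v m" | "covers m v" using edge[OF nz] by blast
    then show False
    proof cases
      case 1
      then have "m \<in> ?S" "rank v < rank m" using nz rank_less by (auto simp: covers_def)
      then show False using v(2) by fastforce
    next
      case 2
      then show False
        using covers_pred_unique[OF 2 u(1)] m total[of m u] uv by (auto simp: covers_def)
    qed
  qed
  moreover define t where "t = c {v, u} * (edge_sign idx v u * monom (mono_lcm {v, u} - v))"
  ultimately have *: "c {v, m} * (edge_sign idx v m * monom (mono_lcm {v, m} - v))
      = (if m = u then t else 0)" for m
    by simp
  have "taylor_diff (I :: ('v, 'k) mpoly set) idx c {v} = t"
    using taylor_diff_singleton[of "I :: ('v, 'k) mpoly set" v idx c, unfolded *] finite_P uv by simp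
  also have "\<dots> = (if idx v < idx u then - 1 else 1) * (monom (mono_lcm {v, u} - v) * c {v, u})"
    by (simp add: t_def edge_sign_def mult.commute)
  finally show False using ker[OF uv(2)] u(2) by (simp add: insert_commute split: if_splits)
qed

text \<open>The coefficient of the largest generator \<open>x\<close> of a relation is divisible by the quotient of
  \<open>lcm(y, x)\<close> by \<open>x\<close>, where \<open>y\<close> is the predecessor of \<open>x\<close>; subtracting a multiple of the boundary
  of the edge \<open>{y, x}\<close> therefore removes \<open>x\<close> from the relation.\<close>

lemma relation_is_boundary:
  fixes h :: "'v mono \<Rightarrow> ('v, 'k::field) mpoly"
  assumes idx: "inj_on idx P"
    and total: "\<And>u v. u \<in> P \<Longrightarrow> v \<in> P \<Longrightarrow> u \<sqsubseteq> v \<or> v \<sqsubseteq> u"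
    and "x \<in> P"
    and "\<And>m. m \<in> P \<Longrightarrow> h m \<in> carrier (poly_ring V)"
    and "\<And>m. m \<in> P \<Longrightarrow> \<not> m \<sqsubseteq> x \<Longrightarrow> h m = 0"
    and "(\<Sum>m\<in>P. h m * monom m) = 0"
  shows "\<exists>g\<in>carrier (free_module (poly_ring V) edges).
    \<forall>m\<in>P. taylor_diff (I :: ('v, 'k) mpoly set) idx g {m} = h m"
  using assms(3-)
proof (induction "rank x" arbitrary: x h rule: less_induct)
  case less
  let ?d = "taylor_diff (I :: ('v, 'k) mpoly set) idx"
  note [simp] = less.prems(1)
  show ?case
  proof (cases "x = bottom")
    case True
    \<comment> \<open>At the bottom a single generator remains, and its monomial is not a zero
      divisor.\<close>
    have zero: "h m = 0" if "m \<in> P" "m \<noteq> x" for m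
      using that less.prems(3)[of m] bottom le_antisym[of m x] True by auto
    have "(\<Sum>m\<in>P. h m * monom m) = (\<Sum>m\<in>P. if m = x then h x * monom x else 0)"
      by (intro sum.cong refl) (auto simp: zero)
    then have "monom x * h x = 0" using less.prems(4) finite_P by (simp add: mult.commute)
    then have "h m = 0" if "m \<in> P" for m using zero that by (cases "m = x") auto
    then show ?thesis
      by (intro bexI[of _ "\<lambda>_. 0"]) (simp_all add: taylor_diff_zero edges_carrier_iff)
  next
    case False
    then obtain y where y: "covers y x" using ex_covers[OF less.prems(1)] by blast
    have yx: "y \<in> P" "y \<sqsubseteq> x" "y \<noteq> x" using y by (auto simp: covers_def)
    have below: "m \<sqsubseteq> y" if "m \<in> P" "m \<sqsubseteq> x" "m \<noteq> x" for m
      using total[OF that(1) yx(1)] that y le_refl[OF yx(1)] unfolding covers_def by blast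
    define e where "e = mono_lcm {y, x} - x"
    \<comment> \<open>The term \<open>x + k\<close> must cancel against a term of some other
      generator \<open>m\<close> below \<open>x\<close>. Then \<open>y\<close> lies between
      \<open>m\<close> and \<open>x\<close>, so \<open>y\<close> divides their lcm, which divides
      \<open>x + k\<close>.\<close>
    have "mono_dvd e k" if k: "k \<in> Poly_Mapping.keys (h x)" for k
    proof -
      have "(\<Sum>m\<in>P. h m * monom m) = h x * monom x + (\<Sum>m\<in>P - {x}. h m * monom m)"
        by (rule sum.remove) (use finite_P in simp_all)
      then have "h x * monom x = - (\<Sum>m\<in>P - {x}. h m * monom m)"
        using less.prems(4) by (simp add: eq_neg_iff_add_eq_0)
      moreover have "Poly_Mapping.lookup (h x * monom x) (x + k) \<noteq> 0"
        using k by (simp add: mult.commute[of "h x"] in_keys_iff)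
      ultimately have "(\<Sum>m\<in>P - {x}. Poly_Mapping.lookup (h m * monom m) (x + k)) \<noteq> 0"
        by (simp add: lookup_sum)
      then obtain m where "m \<in> P - {x}" and m: "Poly_Mapping.lookup (h m * monom m) (x + k) \<noteq> 0"
        by (rule sum.not_neutral_contains_not_neutral)
      then have mP: "m \<in> P" "m \<noteq> x" by simp_all
      have mk: "mono_dvd m (x + k)"
        using m by (simp add: mult.commute[of "h m"] lookup_monom_times split: if_splits)
      have "h m \<noteq> 0" using m by auto
      then have "m \<sqsubseteq> x" using mP(1) less.prems(3) by blast
      then have "mono_dvd y (mono_lcm {m, x})"
        using between[of m y x] below[of m] mP yx by simp
      also have "mono_dvd (mono_lcm {m, x}) (x + k)"
        using mk by (simp add: mono_lcm_dvd_iff)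
      finally have "mono_dvd (mono_lcm {y, x}) (x + k)"
        by (simp add: mono_lcm_dvd_iff)
      then show ?thesis
        by (auto simp: e_def mono_dvd_iff lookup_add lookup_minus) (metis le_diff_conv add.commute)
    qed
    then obtain q where q: "h x = monom e * q"
      "\<And>k. k \<in> Poly_Mapping.keys q \<Longrightarrow> e + k \<in> Poly_Mapping.keys (h x)"
      using monom_times_quotient by blast
    \<comment> \<open>Every exponent of \<open>q\<close> divides an exponent of \<open>h x\<close>,
      so no variable outside \<open>V\<close> can appear.\<close>
    have qR: "q \<in> carrier (poly_ring V)"
      unfolding poly_ring_carrier_iff
    proof
      fix k assume "k \<in> Poly_Mapping.keys q"
      then have "Poly_Mapping.keys (e + k) \<subseteq> V"
        using q(2) less.prems(2)[of x] by (simp add: poly_ring_carrier_iff)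
      then show "Poly_Mapping.keys k \<subseteq> V"
        using keys_mono_mono[OF mono_dvd_add(2)[of k e]] by simp
    qed
    define g0 where "g0 = edge_chain idx y x q"
    have g0: "g0 \<in> carrier (free_module (poly_ring V) edges)"
      unfolding g0_def by (rule edge_chain_carrier[OF y qR])
    have d0: "?d g0 {m} = (if m = x then q * monom e else 0)
        - (if m = y then q * monom (mono_lcm {y, x} - y) else 0)" if "m \<in> P" for m
      unfolding g0_def e_def by (rule taylor_diff_edge_chain[OF idx y that])
    have "\<exists>g\<in>carrier (free_module (poly_ring V) edges). \<forall>m\<in>P. ?d g {m} = h m - ?d g0 {m}"
    proof (rule less.hyps)
      show "rank y < rank x" using yx by (simp add: rank_less)
      show "h m - ?d g0 {m} \<in> carrier (poly_ring V)" if "m \<in> P" for m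
      proof (rule poly_ring_diff[OF less.prems(2)[OF that]])
        have "g0 \<sigma> \<in> carrier (poly_ring V)" for \<sigma>
          using g0 by (cases "\<sigma> \<in> edges") (auto simp: edges_carrier_iff)
        then show "?d g0 {m} \<in> carrier (poly_ring V)"
          by (intro taylor_diff_carrier) (simp_all add: finite_P keys_P)
      qed
      show "h m - ?d g0 {m} = 0" if "m \<in> P" "\<not> m \<sqsubseteq> y" for m
      proof (cases "m = x")
        case True
        then show ?thesis using d0[of x] q(1) yx by (simp add: mult.commute)
      next
        case False
        then have "h m = 0" using less.prems(3) below that by blast
        moreover have "m \<noteq> y" using that le_refl by blast
        ultimately show ?thesis using d0[OF that(1)] False by simp
      qed
      \<comment> \<open>A boundary is itself a relation, so subtracting it leaves a relation to
        which the induction applies.\<close>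
      have "(\<Sum>m\<in>P. ?d g0 {m} * monom m) = 0"
        using taylor_diff_taylor_diff_empty[of "I :: ('v, 'k) mpoly set" idx g0] idx finite_P
        by (simp add: taylor_diff_empty)
      then show "(\<Sum>m\<in>P. (h m - ?d g0 {m}) * monom m) = 0"
        using less.prems(4) by (simp add: left_diff_distrib sum_subtractf)
    qed (rule yx(1))
    then obtain g1 where g1: "g1 \<in> carrier (free_module (poly_ring V) edges)"
      "\<forall>m\<in>P. ?d g1 {m} = h m - ?d g0 {m}" by blast
    show ?thesis
    proof (rule bexI[of _ "\<lambda>\<sigma>. g0 \<sigma> + g1 \<sigma>"])
      show "(\<lambda>\<sigma>. g0 \<sigma> + g1 \<sigma>) \<in> carrier (free_module (poly_ring V) edges)"
        using g0 g1(1) by (auto simp: edges_carrier_iff)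
    qed (use g1(2) in \<open>simp add: taylor_diff_add\<close>)
  qed
qed

section \<open>The Scarf complex as a resolution\<close>

lemma finite_faces: "finite {\<sigma> \<in> scarf_complex (I :: ('v, 'k::field) mpoly set). card \<sigma> = i}"
  by (rule finite_subset[OF _ finite_scarf_complex]) auto

lemma scarf_diff_hom:
  "taylor_diff (I :: ('v, 'k::field) mpoly set) idx \<in> module_hom (poly_ring V)
    (free_module (poly_ring V) {\<sigma> \<in> scarf_complex (I :: ('v, 'k) mpoly set). card \<sigma> = Suc i})
    (free_module (poly_ring V) {\<sigma> \<in> scarf_complex (I :: ('v, 'k) mpoly set). card \<sigma> = i})"
proof (rule module_hom_taylor_diff)
  fix m and \<sigma> :: "'v mono set"
  assume a: "insert m \<sigma> \<in> {\<sigma> \<in> scarf_complex (I :: ('v, 'k) mpoly set). card \<sigma> = Suc i}" "m \<notin> \<sigma>"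
  then have "\<sigma> \<in> scarf_complex (I :: ('v, 'k) mpoly set)" using scarf_complex_remove by blast
  moreover from this have "finite \<sigma>"
    unfolding scarf_complex_def by (auto intro: finite_subset_P)
  ultimately show "\<sigma> \<in> {\<sigma> \<in> scarf_complex (I :: ('v, 'k) mpoly set). card \<sigma> = i}"
    using a by simp
qed (simp_all add: finite_P keys_P finite_faces)

lemma scarf_resolution_exact_0:
  "taylor_diff (I :: ('v, 'k::field) mpoly set) idx ` carrier (free_module (poly_ring V) ((\<lambda>m. {m}) ` P))
    = {f \<in> carrier (free_module (poly_ring V) {{}}). f {} \<in> (I :: ('v, 'k) mpoly set)}"
    (is "?d ` carrier ?F1 = _")
proof -
  have "?d \<in> module_hom (poly_ring V) ?F1 (free_module (poly_ring V) {{}})"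
    using scarf_diff_hom[of idx 0] unfolding faces_0 faces_1 .
  then have hom: "?d f \<in> carrier (free_module (poly_ring V) {{}})" if "f \<in> carrier ?F1" for f
    using that by (auto simp: module_hom_def)
  have "f \<in> ?d ` carrier ?F1"
    if f: "f \<in> carrier (free_module (poly_ring V) {{}})" "f {} \<in> I" for f :: "'v mono set \<Rightarrow> ('v, 'k) mpoly"
  proof -
    obtain h where h: "\<And>a. a \<in> P \<Longrightarrow> h a \<in> carrier (poly_ring V)" "f {} = (\<Sum>a\<in>P. h a * monom a)"
      using monomial_ideal_combination[OF finite_P f(2)] by blast
    let ?g = "\<lambda>\<sigma>. if \<sigma> \<in> (\<lambda>m. {m}) ` P then h (the_elem \<sigma>) else 0"
    have g: "?g \<in> carrier ?F1" using h(1) finite_P by (auto simp: free_module_carrier_iff)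
    have "?d ?g \<tau> = f \<tau>" for \<tau>
    proof (cases "\<tau> = {}")
      case True
      have "?d ?g {} = (\<Sum>m\<in>P. ?g {m} * monom m)"
        by (simp add: taylor_diff_empty finite_P)
      also have "\<dots> = (\<Sum>m\<in>P. h m * monom m)" by (intro sum.cong refl) simp
      finally show ?thesis using True h(2) by simp
    next
      case False
      then show ?thesis using f(1) hom[OF g] by (simp add: free_module_carrier_iff)
    qed
    then have "?d ?g = f" by (rule ext)
    then show ?thesis using g by blast
  qed
  moreover have "?d f {} \<in> I" if f: "f \<in> carrier ?F1" for f
    unfolding taylor_diff_empty[OF finite_mingens_I] mingens_I
  proof (intro monomial_ideal_sum monomial_ideal_mult)
    fix m assume m: "m \<in> P"
    show "monom m \<in> (I :: ('v, 'k) mpoly set)"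
      unfolding monom_in_monomial_ideal_iff using m keys_P[OF m] mono_dvd_refl[of m] by blast
    show "f {m} \<in> carrier (poly_ring V)"
      using f m finite_P by (simp add: free_module_carrier_iff)
  qed
  ultimately show ?thesis using hom by blast
qed

lemma scarf_resolution_exact_1:
  assumes idx: "inj_on idx P"
    and total: "\<And>u v. u \<in> P \<Longrightarrow> v \<in> P \<Longrightarrow> u \<sqsubseteq> v \<or> v \<sqsubseteq> u"
  shows "taylor_diff (I :: ('v, 'k::field) mpoly set) idx ` carrier (free_module (poly_ring V) edges)
    = {f \<in> carrier (free_module (poly_ring V) ((\<lambda>m. {m}) ` P)).
        taylor_diff (I :: ('v, 'k) mpoly set) idx f = (\<lambda>_. 0)}"
    (is "?d ` carrier ?F2 = {f \<in> carrier ?F1. _}")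
proof -
  let ?F0 = "free_module (poly_ring V) {{}} :: (('v, 'k) mpoly, 'v mono set \<Rightarrow> ('v, 'k) mpoly) module"
  have "?d \<in> module_hom (poly_ring V) ?F1 ?F0"
    using scarf_diff_hom[of idx 0] unfolding faces_0 faces_1 .
  then have hom1: "?d f \<in> carrier ?F0" if "f \<in> carrier ?F1" for f
    using that by (auto simp: module_hom_def)
  have "?d \<in> module_hom (poly_ring V) ?F2 ?F1"
    using scarf_diff_hom[of idx "Suc 0"] unfolding faces_1 faces_2 .
  then have hom2: "?d f \<in> carrier ?F1" if "f \<in> carrier ?F2" for f
    using that by (auto simp: module_hom_def)
  have "?d (?d c) = (\<lambda>_. 0)" if "c \<in> carrier ?F2" for c
  proof
    fix \<tau>
    have "?d (?d c) {} = 0"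
      by (rule taylor_diff_taylor_diff_empty) (simp_all add: finite_P idx)
    then show "?d (?d c) \<tau> = 0"
      using hom1[OF hom2[OF that]] by (cases "\<tau> = {}") (auto simp: free_module_carrier_iff)
  qed
  moreover have "f \<in> ?d ` carrier ?F2" if f: "f \<in> carrier ?F1" "?d f = (\<lambda>_. 0)" for f
  proof -
    have "(\<Sum>m\<in>P. f {m} * monom m) = 0"
      using fun_cong[OF f(2), of "{}"] by (simp add: taylor_diff_empty finite_P)
    \<comment> \<open>The elimination starts at \<open>top\<close>, where the requirement that
      coefficients vanish outside the down-set is vacuous.\<close>
    then have "\<exists>g\<in>carrier ?F2. \<forall>m\<in>P. ?d g {m} = f {m}"
      using f(1) top finite_P
      by (intro relation_is_boundary[OF idx total top(1)]) (auto simp: free_module_carrier_iff)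
    then obtain g where g: "g \<in> carrier ?F2" "\<forall>m\<in>P. ?d g {m} = f {m}" by blast
    have "?d g \<tau> = f \<tau>" for \<tau>
      using g(2) f(1) hom2[OF g(1)] finite_P
      by (cases "\<tau> \<in> (\<lambda>m. {m}) ` P") (auto simp: free_module_carrier_iff)
    then have "?d g = f" by (rule ext)
    then show ?thesis using g(1) by blast
  qed
  ultimately show ?thesis using hom2 by blast
qed

text \<open>This translates the kernel in \<open>free_resolution\<close>, an equality of functions,
  into the generatorwise condition used for cycles.\<close>

lemma boundary_eq_zero_iff:
  assumes "c \<in> carrier (free_module (poly_ring V) edges)"
  shows "taylor_diff (I :: ('v, 'k::field) mpoly set) idx c = (\<lambda>_. 0)
    \<longleftrightarrow> (\<forall>m\<in>P. taylor_diff (I :: ('v, 'k) mpoly set) idx c {m} = 0)"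
proof -
  have "taylor_diff (I :: ('v, 'k) mpoly set) idx \<in> module_hom (poly_ring V)
      (free_module (poly_ring V) edges) (free_module (poly_ring V) ((\<lambda>m. {m}) ` P))"
    using scarf_diff_hom[of idx "Suc 0"] unfolding faces_1 faces_2 .
  then have "taylor_diff (I :: ('v, 'k) mpoly set) idx c
      \<in> carrier (free_module (poly_ring V) ((\<lambda>m. {m}) ` P))"
    using assms by (auto simp: module_hom_def)
  then have *: "taylor_diff (I :: ('v, 'k) mpoly set) idx c \<tau> = 0" if "\<tau> \<notin> (\<lambda>m. {m}) ` P" for \<tau>
    using that finite_P by (simp add: free_module_carrier_iff)
  show ?thesis
  proof
    assume zero: "\<forall>m\<in>P. taylor_diff (I :: ('v, 'k) mpoly set) idx c {m} = 0"
    show "taylor_diff (I :: ('v, 'k) mpoly set) idx c = (\<lambda>_. 0)"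
    proof
      show "taylor_diff (I :: ('v, 'k) mpoly set) idx c \<tau> = 0" for \<tau>
        using zero * by (cases "\<tau> \<in> (\<lambda>m. {m}) ` P") auto
    qed
  qed simp
qed

lemma scarf_augmentation:
  fixes f :: "'v mono set \<Rightarrow> ('v, 'k::field) mpoly"
  shows "(\<lambda>f :: 'v mono set \<Rightarrow> ('v, 'k) mpoly. I +>\<^bsub>poly_ring V\<^esub> f {}) \<in> module_hom (poly_ring V) (free_module (poly_ring V) {{}})
      (quotient_module (poly_ring V) (I :: ('v, 'k) mpoly set))" (is "?e \<in> _")
    and "(\<lambda>f :: 'v mono set \<Rightarrow> ('v, 'k) mpoly. I +>\<^bsub>poly_ring V\<^esub> f {}) ` carrier (free_module (poly_ring V) {{}})
      = carrier (quotient_module (poly_ring V) (I :: ('v, 'k) mpoly set))"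
    and "f \<in> carrier (free_module (poly_ring V) {{}}) \<Longrightarrow>
      (I +>\<^bsub>poly_ring V\<^esub> f {} = \<zero>\<^bsub>quotient_module (poly_ring V) I\<^esub>) = (f {} \<in> I)"
proof -
  interpret ideal "I :: ('v, 'k) mpoly set" "poly_ring V" by (rule ideal_monomial_ideal)
  let ?F0 = "free_module (poly_ring V) {{}} :: (('v, 'k) mpoly, 'v mono set \<Rightarrow> ('v, 'k) mpoly) module"
  have coeff: "f {} \<in> carrier (poly_ring V)" if "f \<in> carrier ?F0" for f
    using that by (simp add: free_module_carrier_iff)
  have ops: "(f \<oplus>\<^bsub>?F0\<^esub> g) {} = f {} + g {}" "(r \<odot>\<^bsub>?F0\<^esub> f) {} = r * f {}" for f g r
    by (simp_all add: free_module_def)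
  show "?e \<in> module_hom (poly_ring V) ?F0 (quotient_module (poly_ring V) I)"
    unfolding module_hom_def quotient_module_simps
    using coeff a_rcos_sum rcoset_mult_add a_rcosetsI[OF a_subset] by (simp add: ops)
  show "?e ` carrier ?F0 = carrier (quotient_module (poly_ring V) I)"
  proof
    show "?e ` carrier ?F0 \<subseteq> carrier (quotient_module (poly_ring V) I)"
      unfolding quotient_module_simps using coeff a_rcosetsI[OF a_subset] by auto
    show "carrier (quotient_module (poly_ring V) I) \<subseteq> ?e ` carrier ?F0"
    proof
      fix X :: "('v, 'k) mpoly set" assume "X \<in> carrier (quotient_module (poly_ring V) I)"
      then obtain r where r: "r \<in> carrier (poly_ring V)" "X = I +>\<^bsub>poly_ring V\<^esub> r"
        unfolding quotient_module_simps A_RCOSETS_def' by blast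
      then have "(\<lambda>\<sigma>. if \<sigma> = {} then r else 0) \<in> carrier ?F0"
        by (simp add: free_module_carrier_iff)
      then show "X \<in> ?e ` carrier ?F0" using r(2) by (intro image_eqI) auto
    qed
  qed
  show "(I +>\<^bsub>poly_ring V\<^esub> f {} = \<zero>\<^bsub>quotient_module (poly_ring V) I\<^esub>) = (f {} \<in> I)"
    if "f \<in> carrier ?F0"
    unfolding quotient_module_simps using coeff[OF that] a_rcos_const rcos_const_imp_mem by blast
qed

text \<open>Necessity uses only injectivity on the edges. For sufficiency the total order yields
  exactness at the generators and at the edges; the augmentation and the minimality hold for every
  order.\<close>

lemma scarf_ideal_iff_total:
  "scarf_ideal V (I :: ('v, 'k::field) mpoly set) \<longleftrightarrow> (\<forall>u\<in>P. \<forall>v\<in>P. u \<sqsubseteq> v \<or> v \<sqsubseteq> u)"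
proof
  assume "scarf_ideal V (I :: ('v, 'k) mpoly set)"
  then obtain idx where idx: "bij_betw idx P {1..card P}"
    and res: "free_resolution (poly_ring V) (quotient_module (poly_ring V) (I :: ('v, 'k) mpoly set))
       (\<lambda>i. {\<sigma> \<in> scarf_complex (I :: ('v, 'k) mpoly set). card \<sigma> = i})
       (\<lambda>i. taylor_diff (I :: ('v, 'k) mpoly set) idx) (\<lambda>f. I +>\<^bsub>poly_ring V\<^esub> f {})"
    unfolding scarf_ideal_def minimal_free_resolution_def mingens_I by blast
  have inj: "inj_on idx P" using idx by (rule bij_betw_imp_inj_on)
  \<comment> \<open>Index \<open>Suc 0\<close> of the exactness clause concerns the module on the
    edges, whose incoming module is zero.\<close>
  have "taylor_diff (I :: ('v, 'k) mpoly set) idx ` carrier (free_module (poly_ring V) {})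
    = {f \<in> carrier (free_module (poly_ring V) edges). taylor_diff (I :: ('v, 'k) mpoly set) idx f
      = \<zero>\<^bsub>free_module (poly_ring V) ((\<lambda>m. {m}) ` P)\<^esub>}"
    using res[unfolded free_resolution_def, THEN conjunct2, THEN conjunct2, THEN conjunct2,
      THEN conjunct2, THEN spec, of "Suc 0"]
    unfolding faces_ge_3 faces_2 faces_1 .
  then have ker: "{f \<in> carrier (free_module (poly_ring V) edges).
      taylor_diff (I :: ('v, 'k) mpoly set) idx f = (\<lambda>_. 0)} = {\<lambda>_. 0}"
    unfolding carrier_free_module_empty image_insert image_empty taylor_diff_zero_fun free_module_zero
    by (rule sym)
  have "c = (\<lambda>_. 0)" if "c \<in> carrier (free_module (poly_ring V) edges)"
    "\<forall>m\<in>P. taylor_diff (I :: ('v, 'k) mpoly set) idx c {m} = 0" for c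
    using ker boundary_eq_zero_iff[OF that(1), of idx] that by blast
  then show "\<forall>u\<in>P. \<forall>v\<in>P. u \<sqsubseteq> v \<or> v \<sqsubseteq> u"
    using total_if_injective[OF inj] by blast
next
  assume "\<forall>u\<in>P. \<forall>v\<in>P. u \<sqsubseteq> v \<or> v \<sqsubseteq> u"
  then have total: "\<And>u v. u \<in> P \<Longrightarrow> v \<in> P \<Longrightarrow> u \<sqsubseteq> v \<or> v \<sqsubseteq> u" by blast
  obtain idx where idx: "bij_betw idx P {1..card P}"
    using finite_same_card_bij[of P "{1..card P}"] finite_P by auto
  then have inj: "inj_on idx P" by (rule bij_betw_imp_inj_on)
  let ?d = "taylor_diff (I :: ('v, 'k) mpoly set) idx"
  let ?B = "\<lambda>i. {\<sigma> \<in> scarf_complex (I :: ('v, 'k) mpoly set). card \<sigma> = i}"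
  let ?F = "\<lambda>i. free_module (poly_ring V) (?B i)
    :: (('v, 'k) mpoly, 'v mono set \<Rightarrow> ('v, 'k) mpoly) module"
  have "?d ` carrier (?F (Suc (Suc i))) = {f \<in> carrier (?F (Suc i)). ?d f = (\<lambda>_. 0)}" for i
  proof -
    \<comment> \<open>Index \<open>0\<close> is exactness at the generators and index
      \<open>1\<close> at the edges; for larger \<open>i\<close> both the source and the middle
      module are zero.\<close>
    consider "i = 0" | "i = Suc 0" | j where "i = Suc (Suc j)" by (metis not0_implies_Suc)
    then show ?thesis
    proof cases
      case 1
      show ?thesis unfolding 1 faces_1 faces_2 by (rule scarf_resolution_exact_1[OF inj total])
    next
      case 2
      have "f = (\<lambda>_. 0)" if "f \<in> carrier (free_module (poly_ring V) edges)" "?d f = (\<lambda>_. 0)" for f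
        by (rule injective_if_total[OF total that(1), of idx]) (simp_all add: that(2))
      moreover have "(\<lambda>_. 0) \<in> carrier (free_module (poly_ring V) edges)"
        by (simp add: edges_carrier_iff)
      ultimately have "{f \<in> carrier (free_module (poly_ring V) edges). ?d f = (\<lambda>_. 0)} = {\<lambda>_. 0}"
        using taylor_diff_zero_fun by blast
      then show ?thesis using 2 by (simp only: faces_2 faces_ge_3 carrier_free_module_empty
        image_insert image_empty taylor_diff_zero_fun)
    next
      case (3 j)
      then show ?thesis unfolding 3 faces_ge_3 carrier_free_module_empty
        by (auto simp: taylor_diff_zero_fun)
    qed
  qed
  moreover have "?d ` carrier (?F 1) = {f \<in> carrier (?F 0).
      I +>\<^bsub>poly_ring V\<^esub> f {} = \<zero>\<^bsub>quotient_module (poly_ring V) I\<^esub>}"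
    using scarf_resolution_exact_0[of idx] scarf_augmentation(3)
    unfolding One_nat_def faces_0 faces_1 by blast
  moreover have "\<forall>i. ?d \<in> module_hom (poly_ring V) (?F (Suc i)) (?F i)"
    using scarf_diff_hom by blast
  ultimately have "free_resolution (poly_ring V) (quotient_module (poly_ring V) (I :: ('v, 'k) mpoly set))
       ?B (\<lambda>i. ?d) (\<lambda>f. I +>\<^bsub>poly_ring V\<^esub> f {})"
    unfolding free_resolution_def free_module_zero
    using scarf_augmentation(1,2) unfolding faces_0 by blast
  moreover have "?d f b \<in> irrelevant_ideal V" if "f \<in> carrier (?F (Suc i))" for f i b
    using that
    by (intro taylor_diff_minimal[where B = "?B (Suc i)"]) (auto simp: finite_P keys_P finite_faces)
  ultimately show "scarf_ideal V (I :: ('v, 'k) mpoly set)"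
    unfolding scarf_ideal_def minimal_free_resolution_def mingens_I using idx by blast
qed

end

section \<open>Minimal vertex covers of bipartite graphs\<close>

text \<open>For these exponent vectors divisibility is inclusion of supports, so covers can be
  compared as sets.\<close>

definition sqfree :: "'v set \<Rightarrow> 'v mono" where
  "sqfree W = (\<Sum>x\<in>W. Poly_Mapping.single x 1)"

lemma lookup_sqfree:
  "finite W \<Longrightarrow> Poly_Mapping.lookup (sqfree W) x = (if x \<in> W then 1 else 0)"
  by (simp add: sqfree_def lookup_sum lookup_single when_def)

lemma keys_sqfree [simp]: "finite W \<Longrightarrow> Poly_Mapping.keys (sqfree W) = W"
  by (auto simp: in_keys_iff lookup_sqfree split: if_splits)

lemma sqfree_dvd_iff: "finite W \<Longrightarrow> mono_dvd (sqfree W) m \<longleftrightarrow> W \<subseteq> Poly_Mapping.keys m"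
  by (auto simp: mono_dvd_iff lookup_sqfree in_keys_iff Suc_le_eq)

lemma prod_var_eq: "finite W \<Longrightarrow> (\<Prod>x\<in>W. var x) = monom (sqfree W)"
  by (induction W rule: finite_induct) (simp_all add: sqfree_def var_def monom_mult)

locale bipartite_graph =
  fixes G :: "'v pair_pre_digraph" and X Y :: "'v set"
  assumes pair_graph: "pair_graph G"
    and bipartition: "bipartition G X Y"
    and nonempty: "pverts G \<noteq> {}"
    and no_isolated: "\<And>x. x \<in> pverts G \<Longrightarrow> neighbours G x \<noteq> {}"
begin

lemma verts: "pverts G = X \<union> Y" and disjoint: "X \<inter> Y = {}"
  using bipartition by (auto simp: bipartition_def)

lemma finite_verts: "finite X" "finite Y"
proof -
  interpret pair_graph G by (rule pair_graph)
  show "finite X" "finite Y" using pair_finite_verts verts by auto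
qed

lemma finite_cover: "vertex_cover G W \<Longrightarrow> finite W"
  using finite_verts verts by (auto simp: vertex_cover_def intro: finite_subset)

lemma arc_sym: "(x, y) \<in> parcs G \<Longrightarrow> (y, x) \<in> parcs G"
proof -
  interpret pair_graph G by (rule pair_graph)
  show "(y, x) \<in> parcs G" if "(x, y) \<in> parcs G"
    using pair_sym_arcs that by (auto simp: symmetric_def sym_def)
qed

lemma arc_cases: "(x, y) \<in> parcs G \<Longrightarrow> x \<in> X \<and> y \<in> Y \<or> x \<in> Y \<and> y \<in> X"
  using bipartition by (auto simp: bipartition_def)

lemma vertex_cover_iff:
  "vertex_cover G W \<longleftrightarrow> W \<subseteq> X \<union> Y \<and> (\<forall>x\<in>X. \<forall>y\<in>Y. (x, y) \<in> parcs G \<longrightarrow> x \<in> W \<or> y \<in> W)"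
  unfolding vertex_cover_def verts using arc_cases arc_sym by blast

lemma neighbour_X: "x \<in> X \<Longrightarrow> \<exists>y\<in>Y. (x, y) \<in> parcs G"
  using no_isolated[of x] verts arc_cases[of x] disjoint by (auto simp: neighbours_def)

lemma neighbour_Y:
  assumes "y \<in> Y"
  shows "\<exists>x\<in>X. (x, y) \<in> parcs G"
proof -
  obtain x where x: "(y, x) \<in> parcs G"
    using no_isolated[of y] verts assms by (auto simp: neighbours_def)
  then have "x \<in> X" using arc_cases[OF x] assms disjoint by blast
  then show ?thesis using arc_sym[OF x] by blast
qed

lemma X_nonempty: "X \<noteq> {}" and Y_nonempty: "Y \<noteq> {}"
  using nonempty verts neighbour_X neighbour_Y by auto

definition minimal_cover :: "'v set \<Rightarrow> bool" where
  "minimal_cover W \<longleftrightarrow> vertex_cover G W \<and> (\<forall>W'. vertex_cover G W' \<and> W' \<subseteq> W \<longrightarrow> W' = W)"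

lemma ex_minimal_cover:
  assumes "vertex_cover G W"
  obtains W' where "minimal_cover W'" "W' \<subseteq> W"
proof -
  let ?S = "{W'. vertex_cover G W' \<and> W' \<subseteq> W}"
  have "finite ?S" using finite_cover[OF assms] by (auto intro: finite_subset[of _ "Pow W"])
  then obtain W' where "W' \<in> ?S" "\<forall>U\<in>?S. U \<subseteq> W' \<longrightarrow> W' = U"
    using finite_has_minimal[of ?S] assms by blast
  then have "minimal_cover W'" "W' \<subseteq> W" unfolding minimal_cover_def by auto
  then show thesis by (rule that)
qed

lemma minimal_cover_cover: "minimal_cover W \<Longrightarrow> vertex_cover G W"
  by (simp add: minimal_cover_def)

lemma finite_minimal_cover: "minimal_cover W \<Longrightarrow> finite W"
  using finite_cover minimal_cover_cover by blast

lemma minimal_cover_subset: "minimal_cover W \<Longrightarrow> W \<subseteq> X \<union> Y"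
  using minimal_cover_cover vertex_cover_iff by blast

lemma minimal_cover_edge:
  "minimal_cover W \<Longrightarrow> x \<in> X \<Longrightarrow> y \<in> Y \<Longrightarrow> (x, y) \<in> parcs G \<Longrightarrow> x \<in> W \<or> y \<in> W"
  using minimal_cover_cover vertex_cover_iff by blast

lemma minimal_cover_remove:
  assumes "minimal_cover W" "z \<in> W"
  shows "\<not> vertex_cover G (W - {z})"
  using assms unfolding minimal_cover_def by blast

text \<open>If all neighbours of \<open>x\<close> were in \<open>W\<close>, then \<open>x\<close>
  could be dropped. Such a missing neighbour certifies that \<open>x\<close> is
  indispensable.\<close>

lemma minimal_cover_X:
  assumes W: "minimal_cover W" and x: "x \<in> W" "x \<in> X"
  shows "\<exists>y\<in>Y. y \<notin> W \<and> (x, y) \<in> parcs G"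
proof (rule ccontr)
  assume "\<not> ?thesis"
  then have "vertex_cover G (W - {x})"
    using minimal_cover_subset[OF W] minimal_cover_edge[OF W] x disjoint
    unfolding vertex_cover_iff by blast
  then show False using minimal_cover_remove[OF W x(1)] by blast
qed

lemma minimal_cover_Y:
  assumes W: "minimal_cover W" and y: "y \<in> W" "y \<in> Y"
  shows "\<exists>x\<in>X. x \<notin> W \<and> (x, y) \<in> parcs G"
proof (rule ccontr)
  assume "\<not> ?thesis"
  then have "vertex_cover G (W - {y})"
    using minimal_cover_subset[OF W] minimal_cover_edge[OF W] y disjoint
    unfolding vertex_cover_iff by blast
  then show False using minimal_cover_remove[OF W y(1)] by blast
qed

text \<open>A vertex is in a minimal cover only because some neighbour is not. Enlarging one side
  therefore removes reasons for vertices on the other side, and conversely.\<close>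

lemma minimal_cover_order:
  assumes U: "minimal_cover U" and W: "minimal_cover W"
  shows "U \<inter> X \<subseteq> W \<inter> X \<longleftrightarrow> W \<inter> Y \<subseteq> U \<inter> Y"
proof
  assume sub: "U \<inter> X \<subseteq> W \<inter> X"
  show "W \<inter> Y \<subseteq> U \<inter> Y"
  proof
    fix y assume y: "y \<in> W \<inter> Y"
    then obtain x where x: "x \<in> X" "x \<notin> W" "(x, y) \<in> parcs G"
      using minimal_cover_Y[OF W] by blast
    then have "x \<notin> U" using sub by blast
    then show "y \<in> U \<inter> Y" using minimal_cover_edge[OF U x(1) _ x(3)] y by blast
  qed
next
  assume sub: "W \<inter> Y \<subseteq> U \<inter> Y"
  show "U \<inter> X \<subseteq> W \<inter> X"
  proof
    fix x assume x: "x \<in> U \<inter> X"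
    then obtain y where y: "y \<in> Y" "y \<notin> U" "(x, y) \<in> parcs G"
      using minimal_cover_X[OF U] by blast
    then have "y \<notin> W" using sub by blast
    then show "x \<in> W \<inter> X" using minimal_cover_edge[OF W _ y(1) y(3)] x by blast
  qed
qed

lemma minimal_cover_eq:
  assumes U: "minimal_cover U" and W: "minimal_cover W"
    and "U \<inter> X \<subseteq> W \<inter> X" "W \<inter> X \<subseteq> U \<inter> X"
  shows "U = W"
  using minimal_cover_order[OF U W] minimal_cover_order[OF W U] assms(3,4)
    minimal_cover_subset[OF U] minimal_cover_subset[OF W] by blast

text \<open>The union of a comparable pair has the \<open>X\<close>-part of \<open>W\<close> and the
  \<open>Y\<close>-part of \<open>U\<close>. The condition on the \<open>Y\<close>-part of
  \<open>Z\<close> becomes one on its \<open>X\<close>-part by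
  \<open>minimal_cover_order\<close>.\<close>

lemma minimal_cover_between:
  assumes "minimal_cover U" "minimal_cover Z" "minimal_cover W" "U \<inter> X \<subseteq> W \<inter> X"
  shows "Z \<subseteq> U \<union> W \<longleftrightarrow> U \<inter> X \<subseteq> Z \<inter> X \<and> Z \<inter> X \<subseteq> W \<inter> X"
proof
  assume "Z \<subseteq> U \<union> W"
  moreover have "W \<inter> Y \<subseteq> U \<inter> Y" using minimal_cover_order assms by blast
  ultimately have "Z \<inter> X \<subseteq> W \<inter> X" "Z \<inter> Y \<subseteq> U \<inter> Y" using assms(4) by blast+
  then show "U \<inter> X \<subseteq> Z \<inter> X \<and> Z \<inter> X \<subseteq> W \<inter> X" using minimal_cover_order[of U Z] assms by simp
next
  assume a: "U \<inter> X \<subseteq> Z \<inter> X \<and> Z \<inter> X \<subseteq> W \<inter> X"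
  then have "Z \<inter> Y \<subseteq> U \<inter> Y" using minimal_cover_order[of U Z] assms by simp
  then show "Z \<subseteq> U \<union> W" using a minimal_cover_subset[OF assms(2)] by blast
qed

text \<open>Two covers have a meet, with \<open>X\<close>-part the intersection of their \<open>X\<close>-parts; it need not be
  minimal, but it is contained in their union.\<close>

lemma minimal_cover_incomparable:
  assumes U: "minimal_cover U" and W: "minimal_cover W"
    and inc: "\<not> U \<inter> X \<subseteq> W \<inter> X" "\<not> W \<inter> X \<subseteq> U \<inter> X"
  shows "\<exists>Z. minimal_cover Z \<and> Z \<noteq> U \<and> Z \<noteq> W \<and> Z \<subseteq> U \<union> W"
proof -
  have "vertex_cover G ((U \<inter> W \<inter> X) \<union> ((U \<union> W) \<inter> Y))"
    using minimal_cover_edge[OF U] minimal_cover_edge[OF W] unfolding vertex_cover_iff by blast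
  then obtain Z where Z: "minimal_cover Z" "Z \<subseteq> (U \<inter> W \<inter> X) \<union> ((U \<union> W) \<inter> Y)"
    by (rule ex_minimal_cover)
  \<comment> \<open>The \<open>X\<close>-part of \<open>Z\<close> lies in both covers, whereas by
    incomparability neither \<open>X\<close>-part is contained in the other cover.\<close>
  then have "Z \<inter> X \<subseteq> U \<inter> W" using disjoint by blast
  then have "Z \<noteq> U" "Z \<noteq> W" using inc by blast+
  then show ?thesis using Z by blast
qed

lemma minimal_cover_sides: "minimal_cover X" "minimal_cover Y"
proof -
  have "W = X" if "vertex_cover G W" "W \<subseteq> X" for W
    using that neighbour_X disjoint unfolding vertex_cover_iff by blast
  then show "minimal_cover X" unfolding minimal_cover_def by (auto simp: vertex_cover_iff)
  have "W = Y" if "vertex_cover G W" "W \<subseteq> Y" for W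
    using that neighbour_Y disjoint unfolding vertex_cover_iff by blast
  then show "minimal_cover Y" unfolding minimal_cover_def by (auto simp: vertex_cover_iff)
qed

section \<open>The cover ideal and its ordered generators\<close>

abbreviation gens :: "'v mono set" where
  "gens \<equiv> sqfree ` {W. minimal_cover W}"

text \<open>Every cover contains a minimal one, so its monomial is a multiple of a minimal
  generator.\<close>

lemma cover_ideal_eq:
  "(cover_ideal G :: ('v, 'k::field) mpoly set) = monomial_ideal (pverts G) gens"
proof -
  have "{\<Prod>x\<in>W. var x | W. vertex_cover G W}
      = (monom ` sqfree ` {W. vertex_cover G W} :: ('v, 'k) mpoly set)"
    by (force simp: prod_var_eq finite_cover)
  then have "(cover_ideal G :: ('v, 'k) mpoly set)
      = Idl\<^bsub>poly_ring (pverts G)\<^esub> (monom ` sqfree ` {W. vertex_cover G W})"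
    by (simp only: cover_ideal_def)
  also have "\<dots> = monomial_ideal (pverts G) (sqfree ` {W. vertex_cover G W})"
    by (rule genideal_monom) (auto simp: finite_cover vertex_cover_def)
  also have "\<dots> = monomial_ideal (pverts G) gens"
  proof -
    have "(\<exists>a\<in>sqfree ` {W. vertex_cover G W}. mono_dvd a m) \<longleftrightarrow> (\<exists>a\<in>gens. mono_dvd a m)" for m
    proof
      assume "\<exists>a\<in>sqfree ` {W. vertex_cover G W}. mono_dvd a m"
      then obtain W where W: "vertex_cover G W" "W \<subseteq> Poly_Mapping.keys m"
        by (auto simp: sqfree_dvd_iff finite_cover)
      obtain W' where "minimal_cover W'" "W' \<subseteq> W" using ex_minimal_cover[OF W(1)] .
      then show "\<exists>a\<in>gens. mono_dvd a m"
        using W(2) by (auto simp: sqfree_dvd_iff finite_minimal_cover intro!: exI[of _ W'])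
    qed (use minimal_cover_cover in blast)
    then show ?thesis unfolding monomial_ideal_def by simp
  qed
  finally show ?thesis .
qed

lemma ordered_generators_gens:
  "ordered_generators (pverts G) gens
    (\<lambda>m m'. Poly_Mapping.keys m \<inter> X \<subseteq> Poly_Mapping.keys m' \<inter> X) (sqfree Y) (sqfree X)"
proof
  have "{W. minimal_cover W} \<subseteq> Pow (X \<union> Y)" using minimal_cover_subset by blast
  then show "finite gens" using finite_verts by (intro finite_imageI) (auto intro: finite_subset)
  show "Poly_Mapping.keys m \<subseteq> pverts G" if m: "m \<in> gens" for m
  proof -
    obtain W where "minimal_cover W" "m = sqfree W" using m by blast
    then show ?thesis using minimal_cover_subset verts by (simp add: finite_minimal_cover)
  qed
  show "m = m'" if "m \<in> gens" "m' \<in> gens" "mono_dvd m m'" for m m'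
    using that by (auto simp: sqfree_dvd_iff finite_minimal_cover minimal_cover_def)
  show "0 \<notin> gens"
  proof
    assume "0 \<in> gens"
    then obtain W where W: "minimal_cover W" "sqfree W = 0" by auto
    then have "W = {}" using keys_sqfree[OF finite_minimal_cover[OF W(1)]] by simp
    then show False using minimal_cover_sides(1) X_nonempty W(1) unfolding minimal_cover_def by blast
  qed
  show "m = m'" if "m \<in> gens" "m' \<in> gens"
    "Poly_Mapping.keys m \<inter> X \<subseteq> Poly_Mapping.keys m' \<inter> X"
    "Poly_Mapping.keys m' \<inter> X \<subseteq> Poly_Mapping.keys m \<inter> X" for m m'
  proof -
    from that(1,2) obtain U W where *: "minimal_cover U" "minimal_cover W" "m = sqfree U" "m' = sqfree W"
      by blast
    then have "U = W"
      using minimal_cover_eq[of U W] that(3,4) by (simp add: finite_minimal_cover)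
    then show ?thesis using * by simp
  qed
  \<comment> \<open>Passing to supports turns the lcm into a union; this reduces the remaining
    axioms to statements about covers.\<close>
  have lcm: "mono_dvd (sqfree Z) (mono_lcm {sqfree U, sqfree W}) \<longleftrightarrow> Z \<subseteq> U \<union> W"
    if "minimal_cover U" "minimal_cover Z" "minimal_cover W" for U Z W
    using that by (simp add: sqfree_dvd_iff finite_minimal_cover keys_mono_lcm)
  show "mono_dvd v (mono_lcm {u, w}) \<longleftrightarrow>
      Poly_Mapping.keys u \<inter> X \<subseteq> Poly_Mapping.keys v \<inter> X \<and>
      Poly_Mapping.keys v \<inter> X \<subseteq> Poly_Mapping.keys w \<inter> X"
    if "u \<in> gens" "v \<in> gens" "w \<in> gens" "Poly_Mapping.keys u \<inter> X \<subseteq> Poly_Mapping.keys w \<inter> X" for u v w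
  proof -
    from that obtain U Z W where
      *: "minimal_cover U" "minimal_cover Z" "minimal_cover W" "u = sqfree U" "v = sqfree Z" "w = sqfree W"
      by blast
    then have "U \<inter> X \<subseteq> W \<inter> X" using that(4) by (simp add: finite_minimal_cover)
    then show ?thesis using * minimal_cover_between[OF *(1-3)] lcm[OF *(1-3)]
      by (simp add: finite_minimal_cover)
  qed
  show "\<exists>w\<in>gens. w \<noteq> u \<and> w \<noteq> v \<and> mono_dvd w (mono_lcm {u, v})"
    if "u \<in> gens" "v \<in> gens" "\<not> Poly_Mapping.keys u \<inter> X \<subseteq> Poly_Mapping.keys v \<inter> X"
      "\<not> Poly_Mapping.keys v \<inter> X \<subseteq> Poly_Mapping.keys u \<inter> X" for u v
  proof -
    from that(1,2) obtain U W where *: "minimal_cover U" "minimal_cover W" "u = sqfree U" "v = sqfree W"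
      by blast
    then have "\<not> U \<inter> X \<subseteq> W \<inter> X" "\<not> W \<inter> X \<subseteq> U \<inter> X"
      using that(3,4) by (simp_all add: finite_minimal_cover)
    then obtain Z where Z: "minimal_cover Z" "Z \<noteq> U" "Z \<noteq> W" "Z \<subseteq> U \<union> W"
      using minimal_cover_incomparable[OF *(1,2)] by blast
    then have "sqfree Z \<noteq> u" "sqfree Z \<noteq> v"
      using * by (metis finite_minimal_cover keys_sqfree)+
    then show ?thesis using Z * lcm[of U Z W] by blast
  qed
  show "sqfree Y \<in> gens" "sqfree X \<in> gens" using minimal_cover_sides by blast+
qed (use disjoint in \<open>auto simp: finite_verts finite_minimal_cover dest!: minimal_cover_subset\<close>)

section \<open>From chains of minimal covers to Ferrers graphs\<close>

lemma scarf_iff_chain: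
  "scarf_ideal (pverts G) (cover_ideal G :: ('v, 'k::field) mpoly set)
    \<longleftrightarrow> (\<forall>U W. minimal_cover U \<longrightarrow> minimal_cover W \<longrightarrow> U \<inter> X \<subseteq> W \<inter> X \<or> W \<inter> X \<subseteq> U \<inter> X)"
  unfolding cover_ideal_eq ordered_generators.scarf_ideal_iff_total[OF ordered_generators_gens]
  by (auto simp: finite_minimal_cover)

text \<open>Two vertices of \<open>X\<close> with incomparable neighbourhoods can be separated in
  both ways by minimal covers. Conversely, a minimal cover containing \<open>x\<close> but not
  \<open>x'\<close> needs a neighbour of \<open>x\<close> that is not a neighbour of
  \<open>x'\<close>.\<close>

lemma chain_iff_nested:
  "(\<forall>U W. minimal_cover U \<longrightarrow> minimal_cover W \<longrightarrow> U \<inter> X \<subseteq> W \<inter> X \<or> W \<inter> X \<subseteq> U \<inter> X)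
    \<longleftrightarrow> (\<forall>x\<in>X. \<forall>x'\<in>X. neighbours G x \<subseteq> neighbours G x' \<or> neighbours G x' \<subseteq> neighbours G x)"
proof (intro iffI allI ballI impI)
  fix U W
  assume nested: "\<forall>x\<in>X. \<forall>x'\<in>X. neighbours G x \<subseteq> neighbours G x' \<or> neighbours G x' \<subseteq> neighbours G x"
    and U: "minimal_cover U" and W: "minimal_cover W"
  have no: False if A: "minimal_cover A" and x: "x \<in> X" "x \<in> A" "x' \<in> X" "x' \<notin> A"
    and N: "neighbours G x \<subseteq> neighbours G x'" for A x x'
  proof -
    obtain y where y: "y \<in> Y" "y \<notin> A" "(x, y) \<in> parcs G" using minimal_cover_X[OF A x(2,1)] by blast
    then have "(x', y) \<in> parcs G" using N by (auto simp: neighbours_def)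
    then show False using minimal_cover_edge[OF A x(3) y(1)] y(2) x(4) by blast
  qed
  show "U \<inter> X \<subseteq> W \<inter> X \<or> W \<inter> X \<subseteq> U \<inter> X"
  proof (rule ccontr)
    assume "\<not> ?thesis"
    then obtain x x' where x: "x \<in> X" "x \<in> U" "x \<notin> W" "x' \<in> X" "x' \<in> W" "x' \<notin> U" by blast
    then show False using nested no[OF U x(1,2,4,6)] no[OF W x(4,5,1,3)] by blast
  qed
next
  fix x x'
  assume chain: "\<forall>U W. minimal_cover U \<longrightarrow> minimal_cover W \<longrightarrow> U \<inter> X \<subseteq> W \<inter> X \<or> W \<inter> X \<subseteq> U \<inter> X"
    and x: "x \<in> X" "x' \<in> X"
  have ex: "\<exists>W. minimal_cover W \<and> a \<notin> W \<and> b \<in> W"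
    if ab: "a \<in> X" "b \<in> X" "\<not> neighbours G b \<subseteq> neighbours G a" for a b
  proof -
    obtain y where y: "(b, y) \<in> parcs G" "(a, y) \<notin> parcs G" using ab by (auto simp: neighbours_def)
    \<comment> \<open>Leaving out \<open>a\<close> forces its neighbours in and permits leaving out
      \<open>y\<close>. Any minimal cover inside this one must then take \<open>b\<close> to cover
      the edge from \<open>b\<close> to \<open>y\<close>.\<close>
    have "vertex_cover G ((X - {a}) \<union> (neighbours G a \<inter> Y))"
      unfolding vertex_cover_iff neighbours_def by blast
    then obtain W where W: "minimal_cover W" "W \<subseteq> (X - {a}) \<union> (neighbours G a \<inter> Y)"
      by (rule ex_minimal_cover)
    have "y \<in> Y" "y \<notin> X" using arc_cases[OF y(1)] ab disjoint by blast+
    then have "y \<notin> W" using W(2) y(2) by (auto simp: neighbours_def)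
    then have "b \<in> W" using minimal_cover_edge[OF W(1) ab(2) \<open>y \<in> Y\<close> y(1)] by blast
    moreover have "a \<notin> W" using W(2) ab(1) disjoint by blast
    ultimately show ?thesis using W(1) by blast
  qed
  show "neighbours G x \<subseteq> neighbours G x' \<or> neighbours G x' \<subseteq> neighbours G x"
  proof (rule ccontr)
    assume a: "\<not> ?thesis"
    obtain U where U: "minimal_cover U" "x \<notin> U" "x' \<in> U" using ex[of x x'] a x by blast
    obtain W where W: "minimal_cover W" "x' \<notin> W" "x \<in> W" using ex[of x' x] a x by blast
    show False using chain U W x by blast
  qed
qed

text \<open>Nested finite sets are ordered by their size, so sorting \<open>X\<close> by degree
  gives the required labelling. The last neighbourhood contains all others, and every vertex of
  \<open>Y\<close> has a neighbour.\<close>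

lemma ferrers_graph_if_nested:
  assumes nested: "\<forall>x\<in>X. \<forall>x'\<in>X. neighbours G x \<subseteq> neighbours G x' \<or> neighbours G x' \<subseteq> neighbours G x"
  shows "ferrers_graph G"
proof -
  have N: "neighbours G x \<subseteq> Y" if "x \<in> X" for x
    using that arc_cases disjoint by (auto simp: neighbours_def)
  obtain l where l: "set l = X" "distinct l" using finite_distinct_list finite_verts by blast
  define xs where "xs = sort_key (\<lambda>x. card (neighbours G x)) l"
  have xs: "distinct xs" "set xs = X" using l by (simp_all add: xs_def)
  then have ne: "xs \<noteq> []" using X_nonempty by auto
  have "sorted (map (\<lambda>x. card (neighbours G x)) xs)" by (simp add: xs_def)
  then have card_mono: "card (neighbours G (xs ! i)) \<le> card (neighbours G (xs ! j))"
    if "i \<le> j" "j < length xs" for i j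
    using sorted_nth_mono[of "map (\<lambda>x. card (neighbours G x)) xs" i j] that by simp
  have mono: "neighbours G (xs ! i) \<subseteq> neighbours G (xs ! j)" if ij: "i \<le> j" "j < length xs" for i j
  proof -
    have mem: "xs ! i \<in> X" "xs ! j \<in> X" using ij xs(2) by (auto intro!: nth_mem)
    \<comment> \<open>If nestedness gives the reverse inclusion, the order of the sizes turns it
      into equality.\<close>
    then have "finite (neighbours G (xs ! i))" using N finite_verts finite_subset by blast
    then show ?thesis
      using nested mem card_mono[OF ij] card_seteq[of "neighbours G (xs ! i)" "neighbours G (xs ! j)"]
      by blast
  qed
  have last: "last xs = xs ! (length xs - 1)" using ne by (rule last_conv_nth)
  have "Y \<subseteq> neighbours G (last xs)"
  proof
    fix y assume "y \<in> Y"
    then obtain x where x: "x \<in> X" "y \<in> neighbours G x"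
      using neighbour_Y by (auto simp: neighbours_def)
    then obtain i where i: "i < length xs" "x = xs ! i" using xs(2) by (metis in_set_conv_nth)
    then show "y \<in> neighbours G (last xs)"
      using mono[of i "length xs - 1"] x(2) unfolding last by fastforce
  qed
  moreover have "neighbours G (last xs) \<subseteq> Y" using N xs ne last_in_set by blast
  ultimately have "neighbours G (last xs) = Y" by blast
  then show ?thesis
    unfolding ferrers_graph_def using bipartition xs ne mono
    by (intro exI[of _ X] exI[of _ Y] exI[of _ xs]) simp
qed

end

theorem theorem1p5:
  fixes G :: "'v pair_pre_digraph"
  assumes "pair_graph G"
    and "pverts G \<noteq> {}"
    and "bipartite G"
    and "\<forall>x\<in>pverts G. neighbours G x \<noteq> {}"
  shows "scarf_ideal (pverts G) (cover_ideal G :: ('v, 'k::field) mpoly set) \<longleftrightarrow> ferrers_graph G"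
proof
  assume scarf: "scarf_ideal (pverts G) (cover_ideal G :: ('v, 'k) mpoly set)"
  obtain X Y where "bipartition G X Y" using assms(3) by (auto simp: bipartite_def)
  then interpret bipartite_graph G X Y
    by (rule bipartite_graph.intro[OF assms(1)]) (use assms in auto)
  show "ferrers_graph G"
    using scarf ferrers_graph_if_nested unfolding scarf_iff_chain chain_iff_nested by blast
next
  assume "ferrers_graph G"
  then obtain X Y xs where XY: "bipartition G X Y" and xs: "set xs = X"
    and mono: "\<forall>i. Suc i < length xs \<longrightarrow> neighbours G (xs ! i) \<subseteq> neighbours G (xs ! Suc i)"
    by (auto simp: ferrers_graph_def)
  \<comment> \<open>The Ferrers labelling brings its own bipartition, and a disconnected graph may
    have essentially different ones. As the chain criterion holds for every bipartition, this one is
    used.\<close>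
  interpret bipartite_graph G X Y
    by (rule bipartite_graph.intro[OF assms(1) XY]) (use assms in auto)
  \<comment> \<open>The labelling compares consecutive vertices only; transitivity extends this to
    all pairs.\<close>
  have "transp (\<lambda>x x'. neighbours G x \<subseteq> neighbours G x')" by (auto intro: transpI)
  then have "sorted_wrt (\<lambda>x x'. neighbours G x \<subseteq> neighbours G x') xs"
    using mono by (simp add: sorted_wrt_iff_nth_Suc_transp)
  then have lt: "neighbours G (xs ! i) \<subseteq> neighbours G (xs ! j)" if "i < j" "j < length xs" for i j
    using that by (simp add: sorted_wrt_iff_nth_less)
  have "neighbours G x \<subseteq> neighbours G x' \<or> neighbours G x' \<subseteq> neighbours G x"
    if x: "x \<in> X" "x' \<in> X" for x x'
  proof -
    obtain i j where "i < length xs" "x = xs ! i" "j < length xs" "x' = xs ! j"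
      using x unfolding xs[symmetric] in_set_conv_nth by blast
    then show ?thesis using lt[of i j] lt[of j i] by (cases i j rule: linorder_cases) auto
  qed
  then show "scarf_ideal (pverts G) (cover_ideal G :: ('v, 'k) mpoly set)"
    unfolding scarf_iff_chain chain_iff_nested by (intro ballI)
qed

end
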